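(* Suppose $p=p_n$ satisfies $\lim_{n\to\infty}\frac{\log p}{\sqrt n}=\alpha\in[0,\infty)$. For each $n$ let $\mathbf{X}_1,\dots,\mathbf{X}_p$ be independent $n$-dimensional random vectors with a common spherical distribution (which may depend on $n$) satisfying $P(\mathbf{X}_1=\mathbf{0})=0$, and let $L_n=\max_{1\le i<j\le p}|\rho_{ij}|$, where $\rho_{ij}$ is the Pearson correlation coefficient of $\mathbf{X}_i$ and $\mathbf{X}_j$. Then, as $n\to\infty$, $$nL_n^2-4\log p+\log\log p$$ converges weakly to the distribution with distribution function $\exp\left\{-\frac{1}{\sqrt{8\pi}}e^{-(y+8\alpha^2)/2}\right\}$, $y\in\mathbb{R}$.
   Context: A random vector $\mathbf{Y}\in\mathbb{R}^n$ has a spherical distribution if $\mathbf{O}\mathbf{Y}$ and $\mathbf{Y}$ have the same probability distribution for every $n\times n$ orthogonal matrix $\mathbf{O}$. For $\mathbf{x}=(x_1,\dots,x_n)^T$, $\mathbf{y}=(y_1,\dots,y_n)^T\in\mathbb{R}^n$, the Pearson correlation coefficient is $$\rho_{\mathbf{x},\mathbf{y}}=\frac{\sum_{i=1}^n(x_i-\bar x)(y_i-\bar y)}{\sqrt{\sum_{i=1}^n(x_i-\bar x)^2\cdot\sum_{i=1}^n(y_i-\bar y)^2}},\qquad \bar x=\frac1n\sum_{i=1}^n x_i,\quad \bar y=\frac1n\sum_{i=1}^n y_i,$$ and $\rho_{ij}=\rho_{\mathbf{X}_i,\mathbf{X}_j}$. $\log$ is the natural logarithm, and $p=p_n$ depends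 on $n$ only.
   Formalization: The formal theorem additionally assumes that p_n tends to infinity; without this the claim fails when α = 0 (e.g. p_n = 2 for all n, where the statistic is bounded below by a constant and cannot have the stated limit). *)

theory Defs
  imports "HOL-Probability.Probability"
begin

text \<open>
  The dimension \<open>n\<close> varies inside the limit theorem, so \<open>\<real>\<^sup>n\<close> is represented by the functions
  on the index set \<open>{1..n}\<close> (extended by \<open>undefined\<close>), with the product Borel
  sigma-algebra, which is the Borel sigma-algebra of \<open>\<real>\<^sup>n\<close>.
\<close>

abbreviation borel_vec :: "nat \<Rightarrow> (nat \<Rightarrow> real) measure" where
  "borel_vec n \<equiv> PiM {1..n} (\<lambda>_. borel)"

definition matrix_vec :: "nat \<Rightarrow> (nat \<Rightarrow> nat \<Rightarrow> real) \<Rightarrow> (nat \<Rightarrow> real) \<Rightarrow> (nat \<Rightarrow> real)" where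
  "matrix_vec n A y = (\<lambda>i\<in>{1..n}. \<Sum>j=1..n. A i j * y j)"

text \<open>\<open>A\<^sup>T A = I\<close>, for the entries of \<open>A\<close> with both indices in \<open>{1..n}\<close>.\<close>

definition orthogonal_mat :: "nat \<Rightarrow> (nat \<Rightarrow> nat \<Rightarrow> real) \<Rightarrow> bool" where
  "orthogonal_mat n A \<longleftrightarrow>
     (\<forall>i\<in>{1..n}. \<forall>j\<in>{1..n}. (\<Sum>k=1..n. A k i * A k j) = (if i = j then 1 else 0))"

definition spherical :: "'a measure \<Rightarrow> nat \<Rightarrow> ('a \<Rightarrow> nat \<Rightarrow> real) \<Rightarrow> bool" where
  "spherical M n Y \<longleftrightarrow>
     Y \<in> measurable M (borel_vec n) \<and>
     (\<forall>A. orthogonal_mat n A \<longrightarrow>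
        distr M (borel_vec n) (\<lambda>\<omega>. matrix_vec n A (Y \<omega>)) = distr M (borel_vec n) Y)"

definition mean :: "nat \<Rightarrow> (nat \<Rightarrow> real) \<Rightarrow> real" where
  "mean n x = (1 / real n) * (\<Sum>i=1..n. x i)"

definition pearson :: "nat \<Rightarrow> (nat \<Rightarrow> real) \<Rightarrow> (nat \<Rightarrow> real) \<Rightarrow> real" where
  "pearson n x y =
     (\<Sum>i=1..n. (x i - mean n x) * (y i - mean n y)) /
     sqrt ((\<Sum>i=1..n. (x i - mean n x)\<^sup>2) * (\<Sum>i=1..n. (y i - mean n y)\<^sup>2))"

text \<open>
  The maximum is over a nonempty set only if \<open>p \<ge> 2\<close>; for \<open>p \<le> 1\<close> the value is unspecified.
\<close>

definition coherence :: "nat \<Rightarrow> nat \<Rightarrow> (nat \<Rightarrow> nat \<Rightarrow> real) \<Rightarrow> real" where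
  "coherence n p x = Max {\<bar>pearson n (x i) (x j)\<bar> | i j. 1 \<le> i \<and> i < j \<and> j \<le> p}"

end

theory Submission
  imports Defs "HOL-Real_Asymp.Real_Asymp"
begin

text \<open>
  Call two indices adjacent if the correlation of their vectors exceeds a level \<open>t\<close> in absolute
  value. Then \<open>coherence \<le> t\<close> says that the resulting random graph on \<open>p\<close> vertices has no edge, and
  the theorem is a Poisson limit for the number of edges. Three facts carry it.

  \<^item> The graph has much independence. Spherical symmetry makes the probability that a fixed vector
    \<open>y\<close> is adjacent to a random one the same number \<open>q\<close> for almost every \<open>y\<close>. Hence an edge from a
    vertex to one whose vector has not been revealed yet is independent of everything revealed so
    far; in particular two edges with a common end point occur together with probability \<open>q\<^sup>2\<close>.
    So if \<open>P\<^sub>k\<close> is the probability that the first \<open>k\<close> vertices span no edge, then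
    \<open>P\<^sub>k\<^sub>+\<^sub>1 = P\<^sub>k (1 - k q) + O(k\<^sup>2 q\<^sup>2)\<close>, and iterating gives
    \<open>P\<^sub>p = exp (- q p (p - 1) / 2) + O(p\<^sup>3 q\<^sup>2)\<close> (\<open>prob_no_edge_approx\<close>). The error involves pairs of edges
    only, which is why the dependence among the three edges of a triangle does no harm.

  \<^item> The number \<open>q\<close> is known exactly (\<open>measure_abs_pearson_gt\<close>): the correlation with a fixed
    non-constant \<open>y\<close> has density proportional to \<open>(1 - r\<^sup>2) powr (n / 2 - 2)\<close> on \<open>[- 1, 1]\<close>, that of a
    coordinate of a uniform point on the unit sphere of the \<open>n - 1\<close> dimensional space of centred
    vectors. The reason is that invariance under reflections determines all moments (\<open>moment_recursion\<close>), and moments determine a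
    law on \<open>[- 1, 1]\<close>.

  \<^item> The tail of that density (\<open>scaled_tail_limit\<close>): for \<open>n t\<^sup>2 = y + 4 ln p - ln (ln p)\<close> the product
    \<open>p\<^sup>2 q\<close> tends to \<open>exp (- (y + 8 \<alpha>\<^sup>2) / 2) / sqrt (2 \<pi>)\<close>. The term \<open>8 \<alpha>\<^sup>2\<close> comes from the second order
    of \<open>ln (1 - t\<^sup>2)\<close>, since \<open>n t\<^sup>4\<close> tends to \<open>16 \<alpha>\<^sup>2\<close>.

  As \<open>p\<close> tends to infinity with \<open>p\<^sup>2 q\<close> convergent, the error \<open>p\<^sup>3 q\<^sup>2 = (p\<^sup>2 q)\<^sup>2 / p\<close> vanishes, and the limit
  of the distribution functions is \<open>exp\<close> of minus half the limit of \<open>p\<^sup>2 q\<close>.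
\<close>

section \<open>Random graphs with independent isotropic edges\<close>

text \<open>
  Given the vectors indexed by \<open>J\<close>, the vector of the fresh index \<open>k\<close> is still distributed by its
  own law, and by isotropy its chance to be adjacent to \<open>X i\<close> does not depend on where \<open>X i\<close> lies.
  So the edge is independent of the event \<open>B\<close>, even though \<open>B\<close> may involve \<open>X i\<close>.
\<close>

lemma (in prob_space) prob_edge_to_fresh_vertex:
  assumes indep: "indep_vars (\<lambda>_. N) X I"
    and J: "J \<subseteq> I" "i \<in> J" and k: "k \<in> I" "k \<notin> J"
    and E: "Measurable.pred (N \<Otimes>\<^sub>M N) (\<lambda>z. E (fst z) (snd z))"
    and q: "AE y in distr M N (X i). measure (distr M N (X k)) {x \<in> space N. E x y} = q"
    and B: "B \<in> sets (PiM J (\<lambda>_. N))"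
  shows "prob {\<omega> \<in> space M. (\<lambda>j\<in>J. X j \<omega>) \<in> B \<and> E (X k \<omega>) (X i \<omega>)}
       = q * prob {\<omega> \<in> space M. (\<lambda>j\<in>J. X j \<omega>) \<in> B}"
proof -
  let ?PJ = "PiM J (\<lambda>_. N)"
  let ?Y = "\<lambda>\<omega>. \<lambda>j\<in>J. X j \<omega>"
  have rv: "random_variable N (X j)" if "j \<in> I" for j
    using indep that by (auto simp: indep_vars_def)
  have Xi: "random_variable N (X i)" and Xk: "random_variable N (X k)"
    using rv J k by auto
  have Y: "random_variable ?PJ ?Y"
    using rv J by (intro measurable_restrict) auto
  let ?PK = "PiM {k} (\<lambda>_. N)" and ?Z = "\<lambda>\<omega>. \<lambda>j\<in>{k}. X j \<omega>"
  have ind: "indep_var ?PJ ?Y ?PK ?Z"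
    by (rule indep_var_restrict[OF indep]) (use J k in auto)
  have Z: "random_variable ?PK ?Z"
    using rv k by (intro measurable_restrict) auto
  interpret K: prob_space "distr M N (X k)" using Xk by (rule prob_space_distr)
  interpret KZ: prob_space "distr M ?PK ?Z" using Z by (rule prob_space_distr)
  interpret PY: prob_space "distr M ?PJ ?Y" using Y by (rule prob_space_distr)
  have comp: "(\<lambda>f. f i) \<in> measurable ?PJ N"
    using J by (intro measurable_component_singleton)
  have "Measurable.pred (?PJ \<Otimes>\<^sub>M ?PK) (\<lambda>z. (\<lambda>z. E (fst z) (snd z)) (snd z k, fst z i))"
    by (rule measurable_compose[OF _ E]) (use comp in measurable)
  then have Em: "Measurable.pred (?PJ \<Otimes>\<^sub>M ?PK) (\<lambda>z. E (snd z k) (fst z i))" by simp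
  define W where "W = {z \<in> space (?PJ \<Otimes>\<^sub>M ?PK). fst z \<in> B \<and> E (snd z k) (fst z i)}"
  have "Measurable.pred (?PJ \<Otimes>\<^sub>M ?PK) (\<lambda>z. fst z \<in> B \<and> E (snd z k) (fst z i))"
    using Em B by measurable
  then have W: "W \<in> sets (?PJ \<Otimes>\<^sub>M ?PK)"
    unfolding W_def by measurable
  have qY: "AE f in distr M ?PJ ?Y. measure (distr M N (X k)) {x \<in> space N. E x (f i)} = q"
  proof -
    have "AE \<omega> in M. measure (distr M N (X k)) {x \<in> space N. E x (X i \<omega>)} = q"
      using AE_distrD[OF Xi q] .
    moreover have "Measurable.pred N (\<lambda>y. measure (distr M N (X k)) {x \<in> space N. E x y} = q)"
    proof -
      have "Measurable.pred (N \<Otimes>\<^sub>M N) (\<lambda>z. (\<lambda>z. E (fst z) (snd z)) (snd z, fst z))"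
        by (rule measurable_compose[OF _ E]) measurable
      then have sw: "{z \<in> space (N \<Otimes>\<^sub>M N). E (snd z) (fst z)} \<in> sets (N \<Otimes>\<^sub>M distr M N (X k))"
        by (auto simp: pred_def cong: sets_pair_measure_cong)
      have *: "Pair y -` {z \<in> space (N \<Otimes>\<^sub>M N). E (snd z) (fst z)} = {x \<in> space N. E x y}"
        if "y \<in> space N" for y
        using that by (auto simp: space_pair_measure)
      have "(\<lambda>y. emeasure (distr M N (X k)) (Pair y -` {z \<in> space (N \<Otimes>\<^sub>M N). E (snd z) (fst z)}))
          \<in> borel_measurable N"
        using K.measurable_emeasure_Pair[OF sw] .
      then have "(\<lambda>y. emeasure (distr M N (X k)) {x \<in> space N. E x y}) \<in> borel_measurable N"
        by (rule measurable_cong[THEN iffD1, rotated]) (simp only: *)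
      then have "(\<lambda>y. measure (distr M N (X k)) {x \<in> space N. E x y}) \<in> borel_measurable N"
        unfolding measure_def by measurable
      then show ?thesis by measurable
    qed
    then have "Measurable.pred ?PJ (\<lambda>f. measure (distr M N (X k)) {x \<in> space N. E x (f i)} = q)"
      by (rule measurable_compose[OF comp])
    ultimately show ?thesis
      using J by (subst AE_distr_iff[OF Y]) (auto simp: pred_def)
  qed
  have sec: "emeasure (distr M ?PK ?Z) (Pair f -` W)
      = (if f \<in> B then emeasure (distr M N (X k)) {x \<in> space N. E x (f i)} else 0)"
    if f: "f \<in> space ?PJ" for f
  proof -
    have m: "Measurable.pred N (\<lambda>x. E x (f i))"
    proof -
      have "f i \<in> space N" using f J by (auto simp: space_PiM)
      then have "Measurable.pred N (\<lambda>x. (\<lambda>z. E (fst z) (snd z)) (x, f i))"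
        by (intro measurable_compose[OF _ E]) measurable
      then show ?thesis by simp
    qed
    have "Pair f -` W \<in> sets ?PK" using W by (rule sets_Pair1)
    then have "emeasure (distr M ?PK ?Z) (Pair f -` W) = emeasure M (?Z -` (Pair f -` W) \<inter> space M)"
      using Z by (intro emeasure_distr)
    also have "?Z -` (Pair f -` W) \<inter> space M
        = (if f \<in> B then X k -` {x \<in> space N. E x (f i)} \<inter> space M else {})"
      using f measurable_space[OF Z] measurable_space[OF Xk]
      by (auto simp: W_def space_pair_measure)
    also have "emeasure M \<dots> = (if f \<in> B then emeasure (distr M N (X k)) {x \<in> space N. E x (f i)} else 0)"
      using m Xk by (auto simp: pred_def emeasure_distr)
    finally show ?thesis .
  qed
  have "emeasure M {\<omega> \<in> space M. ?Y \<omega> \<in> B \<and> E (X k \<omega>) (X i \<omega>)}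
      = emeasure M ((\<lambda>\<omega>. (?Y \<omega>, ?Z \<omega>)) -` W \<inter> space M)"
    using J measurable_space[OF Y] measurable_space[OF Z]
    by (intro arg_cong[where f="emeasure M"]) (auto simp: W_def space_pair_measure)
  also have "\<dots> = emeasure (distr M (?PJ \<Otimes>\<^sub>M ?PK) (\<lambda>\<omega>. (?Y \<omega>, ?Z \<omega>))) W"
    using Y Z W by (intro emeasure_distr[symmetric] measurable_Pair)
  also have "\<dots> = emeasure (distr M ?PJ ?Y \<Otimes>\<^sub>M distr M ?PK ?Z) W"
    using ind by (simp add: indep_var_distribution_eq)
  also have "\<dots> = (\<integral>\<^sup>+ f. emeasure (distr M ?PK ?Z) (Pair f -` W) \<partial>distr M ?PJ ?Y)"
    using W by (intro KZ.emeasure_pair_measure_alt) (auto cong: sets_pair_measure_cong)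
  also have "\<dots> = (\<integral>\<^sup>+ f. ennreal q * indicator B f \<partial>distr M ?PJ ?Y)"
  proof (rule nn_integral_cong_AE)
    show "AE f in distr M ?PJ ?Y. emeasure (distr M ?PK ?Z) (Pair f -` W) = ennreal q * indicator B f"
      using qY AE_space
      by eventually_elim (simp add: sec K.emeasure_eq_measure)
  qed
  also have "\<dots> = ennreal q * emeasure (distr M ?PJ ?Y) B"
    using B by (subst nn_integral_cmult) auto
  also have "emeasure (distr M ?PJ ?Y) B = emeasure M {\<omega> \<in> space M. ?Y \<omega> \<in> B}"
    using B Y by (subst emeasure_distr) (auto intro!: arg_cong[where f="emeasure M"])
  finally have *: "emeasure M {\<omega> \<in> space M. ?Y \<omega> \<in> B \<and> E (X k \<omega>) (X i \<omega>)}
      = ennreal q * emeasure M {\<omega> \<in> space M. ?Y \<omega> \<in> B}" .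
  have "0 \<le> q"
  proof -
    have "\<exists>f. measure (distr M N (X k)) {x \<in> space N. E x (f i)} = q"
    proof (rule ccontr)
      assume "\<not> ?thesis"
      then have "AE f in distr M ?PJ ?Y. False" using qY by auto
      then show False by (simp add: PY.AE_False)
    qed
    then show ?thesis using measure_nonneg by metis
  qed
  then show ?thesis
    using arg_cong[OF *, of enn2real]
    by (simp add: measure_def enn2real_mult)
qed

text \<open>
  The second Bonferroni inequality, with the intersections bounded uniformly.
\<close>

lemma (in prob_space) bonferroni_lower:
  assumes "finite I" and A: "\<And>i. i \<in> I \<Longrightarrow> A i \<in> events"
    and pair: "\<And>i j. i \<in> I \<Longrightarrow> j \<in> I \<Longrightarrow> i \<noteq> j \<Longrightarrow> prob (A i \<inter> A j) \<le> c"
  shows "(\<Sum>i\<in>I. prob (A i)) - c * (real (card I) * (real (card I) - 1) / 2) \<le> prob (\<Union>i\<in>I. A i)"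
  using assms
proof (induction I rule: finite_induct)
  case (insert i I)
  let ?U = "\<Union>j\<in>I. A j"
  have U: "?U \<in> events" using insert by auto
  have "prob (A i \<inter> ?U) = prob (\<Union>j\<in>I. A i \<inter> A j)"
    by (rule arg_cong[where f=prob]) auto
  also have "\<dots> \<le> (\<Sum>j\<in>I. prob (A i \<inter> A j))"
    using insert by (intro finite_measure_subadditive_finite) auto
  also have "\<dots> \<le> (\<Sum>j\<in>I. c)" using insert by (intro sum_mono) auto
  finally have "prob (A i \<inter> ?U) \<le> card I * c" by simp
  moreover have "prob (A i \<union> ?U) = prob (A i) + prob ?U - prob (A i \<inter> ?U)"
    using U insert by (subst measure_Un3) (auto simp: fmeasurable_eq_sets)
  moreover have "(\<Sum>i\<in>I. prob (A i)) - c * (real (card I) * (real (card I) - 1) / 2) \<le> prob ?U"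
    using insert by auto
  ultimately show ?case
    using insert by (simp add: field_simps)
qed simp

lemma exp_minus_linear_bounds:
  fixes x :: real assumes "0 \<le> x" shows "0 \<le> exp (- x) - (1 - x)" "exp (- x) - (1 - x) \<le> x\<^sup>2 / 2"
proof -
  show "0 \<le> exp (- x) - (1 - x)" using exp_ge_add_one_self[of "-x"] by simp
  define g where "g = (\<lambda>x::real. 1 - x + x\<^sup>2 / 2 - exp (- x))"
  have "g 0 \<le> g x"
  proof (rule DERIV_nonneg_imp_nondecreasing[OF assms])
    fix z :: real
    have "(g has_real_derivative (- 1 + z + exp (- z))) (at z)"
      unfolding g_def by (auto intro!: derivative_eq_intros)
    then show "\<exists>y. (g has_real_derivative y) (at z) \<and> 0 \<le> y"
      using exp_ge_add_one_self[of "-z"] by auto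
  qed
  then show "exp (- x) - (1 - x) \<le> x\<^sup>2 / 2" by (simp add: g_def)
qed

text \<open>
  Vertices are revealed one by one. If \<open>P\<^sub>k\<close> is the probability of no edge among the first \<open>k\<close>, then the
  probability that vertex \<open>k + 1\<close> brings the first edge lies between \<open>k q P\<^sub>k - k\<^sup>2 q\<^sup>2 / 2\<close>, by Bonferroni,
  and \<open>k q P\<^sub>k\<close>, by the union bound. Replacing \<open>1 - k q\<close> by \<open>exp (- k q)\<close> costs at most \<open>k\<^sup>2 q\<^sup>2 / 2\<close> again. These
  errors merely add up because the factors \<open>exp (- k q)\<close> are at most 1.
\<close>

theorem (in prob_space) prob_no_edge_approx:
  fixes X :: "nat \<Rightarrow> 'a \<Rightarrow> 'b"
  assumes indep: "indep_vars (\<lambda>_. N) X {1..p}"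
    and E: "Measurable.pred (N \<Otimes>\<^sub>M N) (\<lambda>z. E (fst z) (snd z))"
    and sym: "\<And>x y. E x y \<Longrightarrow> E y x"
    and q: "\<And>i k. i \<in> {1..p} \<Longrightarrow> k \<in> {1..p} \<Longrightarrow> i \<noteq> k \<Longrightarrow>
       AE y in distr M N (X i). measure (distr M N (X k)) {x \<in> space N. E x y} = q"
    and q0: "0 \<le> q"
  shows "\<bar>prob {\<omega> \<in> space M. \<forall>i j. 1 \<le> i \<and> i < j \<and> j \<le> p \<longrightarrow> \<not> E (X i \<omega>) (X j \<omega>)}
       - exp (- (q * real p * (real p - 1) / 2))\<bar> \<le> real p ^ 3 * q\<^sup>2"
proof -
  define A where "A i j = {\<omega> \<in> space M. E (X i \<omega>) (X j \<omega>)}" for i j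
  define S where "S k = {\<omega> \<in> space M. \<forall>i j. 1 \<le> i \<and> i < j \<and> j \<le> k \<longrightarrow> \<not> E (X i \<omega>) (X j \<omega>)}" for k
  have Asym: "A i j = A j i" for i j unfolding A_def using sym by blast
  have rv: "random_variable N (X j)" if "j \<in> {1..p}" for j
    using indep that by (auto simp: indep_vars_def)
  have Em: "Measurable.pred L (\<lambda>\<omega>. E (f \<omega>) (g \<omega>))" if "f \<in> measurable L N" "g \<in> measurable L N"
    for L :: "'c measure" and f g
  proof -
    have "Measurable.pred L (\<lambda>\<omega>. (\<lambda>z. E (fst z) (snd z)) (f \<omega>, g \<omega>))"
      by (rule measurable_compose[OF _ E]) (use that in measurable)
    then show ?thesis by simp
  qed
  have A: "A i j \<in> events" if "i \<in> {1..p}" "j \<in> {1..p}" for i j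
    using Em[OF rv rv, OF that] unfolding A_def by measurable
  have S: "S k \<in> events" if "k \<le> p" for k
  proof -
    have "S k = space M - (\<Union>j\<in>{1..k}. \<Union>i\<in>{1..<j}. A i j)"
      unfolding S_def A_def by force
    then show ?thesis
      using that A by auto
  qed
  have edge: "prob (A i k) = q" if "i \<in> {1..p}" "k \<in> {1..p}" "i \<noteq> k" for i k
  proof -
    have "(\<lambda>j\<in>{i}. X j \<omega>) \<in> space (PiM {i} (\<lambda>_. N))" if "\<omega> \<in> space M" for \<omega>
      using measurable_space[OF rv, OF \<open>i \<in> _\<close> that] by (auto simp: space_PiM)
    then have "{\<omega> \<in> space M. (\<lambda>j\<in>{i}. X j \<omega>) \<in> space (PiM {i} (\<lambda>_. N)) \<and> E (X k \<omega>) (X i \<omega>)} = A i k"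
      and "{\<omega> \<in> space M. (\<lambda>j\<in>{i}. X j \<omega>) \<in> space (PiM {i} (\<lambda>_. N))} = space M"
      by (auto simp: A_def intro: sym)
    then show ?thesis
      using prob_edge_to_fresh_vertex[OF indep, of "{i}" i k E q "space (PiM {i} (\<lambda>_. N))", OF _ _ _ _ E q] that
      by (auto simp: prob_space)
  qed
  \<comment> \<open>Here the fresh vertex is the end point \<open>i\<close>, and \<open>B\<close> is the edge between \<open>j\<close> and \<open>k\<close>.\<close>
  have pair: "prob (A i k \<inter> A j k) = q\<^sup>2" if "i \<in> {1..p}" "j \<in> {1..p}" "k \<in> {1..p}" "i \<noteq> j" "i \<noteq> k" "j \<noteq> k" for i j k
  proof -
    define B where "B = {f \<in> space (PiM {j,k} (\<lambda>_. N)). E (f j) (f k)}"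
    have "B \<in> sets (PiM {j,k} (\<lambda>_. N))"
    proof -
      have "Measurable.pred (PiM {j,k} (\<lambda>_. N)) (\<lambda>f. E (f j) (f k))"
        by (rule Em) auto
      then show ?thesis unfolding B_def by measurable
    qed
    from prob_edge_to_fresh_vertex[OF indep, of "{j,k}" k i E q B, OF _ _ _ _ E q this]
    have "prob {\<omega> \<in> space M. (\<lambda>l\<in>{j,k}. X l \<omega>) \<in> B \<and> E (X i \<omega>) (X k \<omega>)}
        = q * prob {\<omega> \<in> space M. (\<lambda>l\<in>{j,k}. X l \<omega>) \<in> B}"
      using that by auto
    moreover have mem: "(\<lambda>l\<in>{j,k}. X l \<omega>) \<in> B \<longleftrightarrow> E (X j \<omega>) (X k \<omega>)" if "\<omega> \<in> space M" for \<omega>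
      using rv[of j] rv[of k] \<open>j \<in> _\<close> \<open>k \<in> _\<close> that by (auto simp: B_def space_PiM dest: measurable_space)
    moreover have "{\<omega> \<in> space M. (\<lambda>l\<in>{j,k}. X l \<omega>) \<in> B \<and> E (X i \<omega>) (X k \<omega>)} = A i k \<inter> A j k"
      using mem by (auto simp: A_def)
    moreover have "{\<omega> \<in> space M. (\<lambda>l\<in>{j,k}. X l \<omega>) \<in> B} = A j k"
      using mem by (auto simp: A_def)
    ultimately show ?thesis using edge[of j k] that by (simp add: power2_eq_square)
  qed
  \<comment> \<open>Here the fresh vertex is \<open>k + 1\<close>, and \<open>B\<close> says that the earlier vertices span no edge.\<close>
  have fresh: "prob (S k \<inter> A i (Suc k)) = q * prob (S k)" if "i \<in> {1..k}" "Suc k \<le> p" for i k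
  proof -
    define B where "B = {f \<in> space (PiM {1..k} (\<lambda>_. N)). \<forall>i\<in>{1..k}. \<forall>j\<in>{1..k}. i < j \<longrightarrow> \<not> E (f i) (f j)}"
    have B: "B \<in> sets (PiM {1..k} (\<lambda>_. N))"
    proof -
      have [measurable]: "Measurable.pred (PiM {1..k} (\<lambda>_. N)) (\<lambda>f. E (f i) (f j))"
        if "i \<in> {1..k}" "j \<in> {1..k}" for i j
        by (rule Em) (use that in auto)
      show ?thesis unfolding B_def by measurable
    qed
    have "AE y in distr M N (X i). measure (distr M N (X (Suc k))) {x \<in> space N. E x y} = q"
      using that by (intro q) auto
    from prob_edge_to_fresh_vertex[OF indep, of "{1..k}" i "Suc k" E q B, OF _ _ _ _ E this B]
    have *: "prob {\<omega> \<in> space M. (\<lambda>l\<in>{1..k}. X l \<omega>) \<in> B \<and> E (X (Suc k) \<omega>) (X i \<omega>)}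
        = q * prob {\<omega> \<in> space M. (\<lambda>l\<in>{1..k}. X l \<omega>) \<in> B}"
      using that by auto
    have mem: "(\<lambda>l\<in>{1..k}. X l \<omega>) \<in> B \<longleftrightarrow> (\<forall>i j. 1 \<le> i \<and> i < j \<and> j \<le> k \<longrightarrow> \<not> E (X i \<omega>) (X j \<omega>))"
      if "\<omega> \<in> space M" for \<omega>
    proof -
      have "(\<lambda>l\<in>{1..k}. X l \<omega>) \<in> space (PiM {1..k} (\<lambda>_. N))"
        using rv \<open>Suc k \<le> p\<close> that
        by (auto simp: space_PiM PiE_def intro!: measurable_space[OF rv])
      then show ?thesis by (auto simp: B_def)
    qed
    have "{\<omega> \<in> space M. (\<lambda>l\<in>{1..k}. X l \<omega>) \<in> B \<and> E (X (Suc k) \<omega>) (X i \<omega>)} = S k \<inter> A i (Suc k)"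
      using mem by (auto simp: S_def A_def intro: sym)
    moreover have "{\<omega> \<in> space M. (\<lambda>l\<in>{1..k}. X l \<omega>) \<in> B} = S k"
      using mem by (auto simp: S_def)
    ultimately show ?thesis using * by simp
  qed
  have step: "\<bar>prob (S (Suc k)) - prob (S k) * exp (- (real k * q))\<bar> \<le> (real k)\<^sup>2 * q\<^sup>2" if kp: "Suc k \<le> p" for k
  proof -
    let ?T = "\<lambda>i. S k \<inter> A i (Suc k)"
    have T: "?T i \<in> events" if "i \<in> {1..k}" for i using S[of k] A[of i "Suc k"] kp that by auto
    have UT: "(\<Union>i\<in>{1..k}. ?T i) \<in> events" using T by blast
    have "S (Suc k) = S k - (\<Union>i\<in>{1..k}. ?T i)"
      unfolding S_def A_def by (auto simp: le_Suc_eq) 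
    then have PS: "prob (S (Suc k)) = prob (S k) - prob (\<Union>i\<in>{1..k}. ?T i)"
      using finite_measure_Diff[OF S UT] kp by auto
    have sumT: "(\<Sum>i\<in>{1..k}. prob (?T i)) = real k * q * prob (S k)"
      using fresh kp by simp
    have up: "prob (\<Union>i\<in>{1..k}. ?T i) \<le> real k * q * prob (S k)"
    proof -
      have "?T ` {1..k} \<subseteq> events" using T by blast
      from finite_measure_subadditive_finite[OF finite_atLeastAtMost this] show ?thesis unfolding sumT .
    qed
    have "prob (?T i \<inter> ?T j) \<le> q\<^sup>2" if "i \<in> {1..k}" "j \<in> {1..k}" "i \<noteq> j" for i j
    proof -
      have "prob (?T i \<inter> ?T j) \<le> prob (A i (Suc k) \<inter> A j (Suc k))"
        using A kp that by (intro finite_measure_mono) auto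
      also have "\<dots> = q\<^sup>2" using pair kp that by auto
      finally show ?thesis .
    qed
    from bonferroni_lower[of "{1..k}" ?T, OF _ T this]
    have lo: "real k * q * prob (S k) - q\<^sup>2 * (real k * (real k - 1) / 2) \<le> prob (\<Union>i\<in>{1..k}. ?T i)"
      unfolding sumT by simp
    have "q\<^sup>2 * (real k * (real k - 1) / 2) \<le> q\<^sup>2 * ((real k)\<^sup>2 / 2)"
      by (intro mult_left_mono) (auto simp: power2_eq_square algebra_simps)
    moreover have "prob (S (Suc k)) - prob (S k) * (1 - real k * q)
        = real k * q * prob (S k) - prob (\<Union>i\<in>{1..k}. ?T i)"
      unfolding PS by (simp add: algebra_simps)
    ultimately have a: "\<bar>prob (S (Suc k)) - prob (S k) * (1 - real k * q)\<bar> \<le> q\<^sup>2 * ((real k)\<^sup>2 / 2)"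
      using lo up by linarith
    have "0 \<le> real k * q" using q0 by simp
    note ex = exp_minus_linear_bounds[OF this]
    have "\<bar>prob (S k) * exp (- (real k * q)) - prob (S k) * (1 - real k * q)\<bar>
        = prob (S k) * (exp (- (real k * q)) - (1 - real k * q))"
      using ex(1) by (simp add: right_diff_distrib[symmetric] abs_mult)
    also have "\<dots> \<le> 1 * ((real k * q)\<^sup>2 / 2)"
      using ex by (intro mult_mono) auto
    also have "\<dots> = q\<^sup>2 * ((real k)\<^sup>2 / 2)" by (simp add: power_mult_distrib)
    finally have "\<bar>prob (S k) * exp (- (real k * q)) - prob (S k) * (1 - real k * q)\<bar>
        \<le> q\<^sup>2 * ((real k)\<^sup>2 / 2)" .
    moreover have "(real k)\<^sup>2 * q\<^sup>2 = 2 * (q\<^sup>2 * ((real k)\<^sup>2 / 2))" by simp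
    ultimately show ?thesis using a by linarith
  qed
  have main: "\<bar>prob (S k) - exp (- (q * real k * (real k - 1) / 2))\<bar> \<le> (\<Sum>i<k. (real i)\<^sup>2 * q\<^sup>2)" if "k \<le> p" for k
    using that
  proof (induction k)
    case 0
    have "S 0 = space M" by (auto simp: S_def)
    then show ?case by (simp add: prob_space)
  next
    case (Suc k)
    let ?e = "\<lambda>k::nat. exp (- (q * real k * (real k - 1) / 2))"
    have e: "?e (Suc k) = ?e k * exp (- (real k * q))"
      by (simp add: exp_add[symmetric] field_simps)
    have "\<bar>prob (S k) * exp (- (real k * q)) - ?e (Suc k)\<bar> = \<bar>prob (S k) - ?e k\<bar> * exp (- (real k * q))"
      unfolding e by (simp add: abs_mult left_diff_distrib[symmetric])
    also have "\<dots> \<le> \<bar>prob (S k) - ?e k\<bar> * 1" using q0 by (intro mult_left_mono) auto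
    finally show ?case using Suc step[of k] by simp
  qed
  have "(\<Sum>i<p. (real i)\<^sup>2 * q\<^sup>2) \<le> (\<Sum>i<p. (real p)\<^sup>2 * q\<^sup>2)"
    by (intro sum_mono mult_right_mono power_mono) auto
  also have "\<dots> = real p ^ 3 * q\<^sup>2" by (simp add: power3_eq_cube power2_eq_square)
  finally show ?thesis using main[of p] unfolding S_def by simp
qed

section \<open>The tail of the density of a coordinate on the sphere\<close>

text \<open>
  Up to normalisation, the density of one coordinate of a uniform point on the unit sphere in
  dimension \<open>n - 1\<close>, the dimension of the space of centred vectors.
\<close>

definition sphere_weight :: "nat \<Rightarrow> real \<Rightarrow> real" where
  "sphere_weight n r = (1 - r\<^sup>2) powr (real n / 2 - 2)"

definition sphere_tail :: "nat \<Rightarrow> real \<Rightarrow> real" where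
  "sphere_tail n t = integral {t..1} (sphere_weight n)"

lemma continuous_on_sphere_weight:
  assumes "n \<ge> 5" "S \<subseteq> {-1..1}" shows "continuous_on S (sphere_weight n)"
proof -
  have "1 - r\<^sup>2 \<ge> 0" if "r \<in> S" for r
    using that assms by (auto simp: abs_square_le_1 abs_le_iff)
  then show ?thesis
    unfolding sphere_weight_def using assms
    by (intro continuous_on_powr') (auto intro!: continuous_intros)
qed

lemma one_minus_square_powr_deriv:
  fixes r b :: real
  assumes "-1 < r" "r < 1"
  shows "((\<lambda>r. (1 - r\<^sup>2) powr b) has_real_derivative (- 2 * b * r * (1 - r\<^sup>2) powr (b - 1))) (at r)"
proof -
  have "r\<^sup>2 < 1" using assms by (simp add: abs_square_less_1 abs_less_iff)
  then show ?thesis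
    by (auto intro!: derivative_eq_intros simp: field_simps powr_diff)
qed

text \<open>
  With \<open>b = n / 2 - 1\<close>, the function \<open>F r = - (1 - r\<^sup>2) powr b / r\<close> is nearly a primitive of
  \<open>2 b\<close> times the weight: its derivative exceeds that by \<open>(1 - r\<^sup>2) powr b / r\<^sup>2\<close>, which on \<open>[t, 1]\<close>
  lies between \<open>0\<close> and \<open>1 / t\<^sup>2\<close> times the weight. Both bounds are read off from the integral of \<open>F'\<close>.
\<close>

lemma sphere_tail_bounds:
  assumes n: "n \<ge> 5" and t: "0 < t" "t < 1"
  defines "B \<equiv> (1 - t\<^sup>2) powr (real n / 2 - 1) / t"
  shows "B / (real n - 2 + 1 / t\<^sup>2) \<le> sphere_tail n t"
    and "sphere_tail n t \<le> B / (real n - 2)"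
proof -
  define b where "b = real n / 2 - 1"
  let ?F = "\<lambda>r. - ((1 - r\<^sup>2) powr b / r)"
  let ?f = "\<lambda>r. 2 * b * (1 - r\<^sup>2) powr (b - 1) + (1 - r\<^sup>2) powr b / r\<^sup>2"
  have b: "b > 0" "b - 1 > 0" "b - 1 = real n / 2 - 2" using n by (auto simp: b_def)
  have sq: "1 - r\<^sup>2 \<ge> 0" "1 - r\<^sup>2 \<le> 1" if "r \<in> {t..1}" for r
    using that t by (auto simp: abs_square_le_1)
  have "(?f has_integral (?F 1 - ?F t)) {t..1}"
  proof (rule fundamental_theorem_of_calculus_interior)
    show "continuous_on {t..1} ?F"
      using sq t b by (intro continuous_intros continuous_on_powr') auto
    fix r assume r: "r \<in> {t<..<1}"
    have "(?F has_real_derivative ?f r) (at r)"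
      by (rule DERIV_cong[OF DERIV_minus[OF DERIV_divide[OF one_minus_square_powr_deriv[where b=b] DERIV_ident]]])
         (use r t in \<open>auto simp: field_simps power2_eq_square\<close>)
    then show "(?F has_vector_derivative ?f r) (at r)"
      by (simp add: has_real_derivative_iff_has_vector_derivative)
  qed (use t in auto)
  then have f: "(?f has_integral B) {t..1}" by (simp add: B_def b_def)
  have w: "(sphere_weight n has_integral sphere_tail n t) {t..1}"
    unfolding sphere_tail_def using t n
    by (intro integrable_integral integrable_continuous_real continuous_on_sphere_weight) auto
  have "2 * b * sphere_tail n t \<le> B"
    by (rule has_integral_le[OF has_integral_mult_right[OF w] f])
       (auto simp: sphere_weight_def b(3)[symmetric])
  then show "sphere_tail n t \<le> B / (real n - 2)" using n by (simp add: b_def field_simps)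
  have "B \<le> (2 * b + 1 / t\<^sup>2) * sphere_tail n t"
  proof (rule has_integral_le[OF f has_integral_mult_right[OF w]])
    fix r assume r: "r \<in> {t..1}"
    have "(1 - r\<^sup>2) powr b \<le> (1 - r\<^sup>2) powr (b - 1)"
      using sq[OF r] by (cases "1 - r\<^sup>2 = 0") (auto intro: powr_mono')
    moreover have "1 / r\<^sup>2 \<le> 1 / t\<^sup>2" using r t by (intro divide_left_mono power_mono) auto
    ultimately have "(1 - r\<^sup>2) powr b * (1 / r\<^sup>2) \<le> (1 - r\<^sup>2) powr (b - 1) * (1 / t\<^sup>2)"
      by (intro mult_mono) auto
    then show "?f r \<le> (2 * b + 1 / t\<^sup>2) * sphere_weight n r"
      by (simp add: sphere_weight_def b(3)[symmetric] algebra_simps)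
  qed
  moreover have "2 * b + 1 / t\<^sup>2 > 0" using b by (intro add_pos_nonneg) auto
  ultimately have "B / (2 * b + 1 / t\<^sup>2) \<le> sphere_tail n t"
    by (simp add: divide_le_eq mult.commute)
  then show "B / (real n - 2 + 1 / t\<^sup>2) \<le> sphere_tail n t" by (simp add: b_def)
qed

text \<open>
  The function \<open>r ^ (2 k + 1) * (1 - r\<^sup>2) powr (n / 2 - 1)\<close> vanishes at both ends, so the integral of
  its derivative is zero.
\<close>

lemma sphere_weight_moments:
  assumes n: "n \<ge> 5"
  shows "(2 * real k + 1) * integral {-1..1} (\<lambda>r. r ^ (2 * k) * sphere_weight n r)
       = (2 * real k + real n - 1) * integral {-1..1} (\<lambda>r. r ^ (2 * k + 2) * sphere_weight n r)"
proof -
  define b where "b = real n / 2 - 1"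
  have b: "b > 0" "b - 1 > 0" "b - 1 = real n / 2 - 2" using n by (auto simp: b_def)
  let ?w = "sphere_weight n"
  let ?F = "\<lambda>r. r ^ (2 * k + 1) * (1 - r\<^sup>2) powr b"
  let ?f = "\<lambda>r. (2 * real k + 1) * (r ^ (2 * k) * ?w r) - (2 * real k + real n - 1) * (r ^ (2 * k + 2) * ?w r)"
  have sq: "1 - r\<^sup>2 \<ge> 0" if "r \<in> {-1..1}" for r :: real
    using that by (auto simp: abs_square_le_1)
  have "(?f has_integral (?F 1 - ?F (-1))) {-1..1}"
  proof (rule fundamental_theorem_of_calculus_interior)
    show "continuous_on {-1..1} ?F"
      using sq b by (intro continuous_intros continuous_on_powr') auto
    fix r :: real assume r: "r \<in> {-1<..<1}"
    have "r\<^sup>2 < 1" using r by (simp add: abs_square_less_1 abs_less_iff)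
    then have *: "(1 - r\<^sup>2) powr b = (1 - r\<^sup>2) * ?w r"
      using powr_mult_base[of "1 - r\<^sup>2" "b - 1"] by (simp add: sphere_weight_def b_def)
    have "(?F has_real_derivative (real (2 * k + 1) * r ^ (2 * k) * (1 - r\<^sup>2) powr b
        + r ^ (2 * k + 1) * (- 2 * b * r * (1 - r\<^sup>2) powr (b - 1)))) (at r)"
      by (rule derivative_eq_intros one_minus_square_powr_deriv[where b=b] refl)+
         (use r in \<open>auto simp: algebra_simps\<close>)
    also have "real (2 * k + 1) * r ^ (2 * k) * (1 - r\<^sup>2) powr b
        + r ^ (2 * k + 1) * (- 2 * b * r * (1 - r\<^sup>2) powr (b - 1)) = ?f r"
      unfolding * unfolding b(3) sphere_weight_def[symmetric]
      by (simp add: b_def algebra_simps power2_eq_square)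
    finally show "(?F has_vector_derivative ?f r) (at r)"
      by (simp add: has_real_derivative_iff_has_vector_derivative)
  qed auto
  then have f: "(?f has_integral 0) {-1..1}" using b by simp
  have i: "(\<lambda>r. r ^ j * ?w r) integrable_on {-1..1}" for j
    using n by (intro integrable_continuous_real continuous_intros continuous_on_sphere_weight) auto
  show ?thesis
    using has_integral_unique[OF f has_integral_diff[OF
        has_integral_mult_right[OF integrable_integral[OF i]]
        has_integral_mult_right[OF integrable_integral[OF i]]]] by simp
qed

lemma sphere_weight_minus [simp]: "sphere_weight n (- r) = sphere_weight n r"
  by (simp add: sphere_weight_def)

lemma sphere_weight_nonneg [simp]: "0 \<le> sphere_weight n r"
  by (simp add: sphere_weight_def)

lemma sphere_weight_odd_moment:
  assumes "n \<ge> 5" "odd k"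
  shows "integral {-1..1} (\<lambda>r. r ^ k * sphere_weight n r) = 0"
proof -
  have "integral {-1..1} (\<lambda>r. r ^ k * sphere_weight n r)
      = integral {-1..1} (\<lambda>r. (- r) ^ k * sphere_weight n (- r))"
    using Henstock_Kurzweil_Integration.integral_reflect_real[of 1 "-1" "\<lambda>r. r ^ k * sphere_weight n r"] by simp
  then show ?thesis using assms by simp
qed

text \<open>
  Laplace's method: with \<open>a = n / 2 - 2\<close>, substituting \<open>r = v / sqrt a\<close> turns the integrand into
  \<open>(1 - v\<^sup>2 / a) powr a\<close>, which is dominated by its limit \<open>exp (- v\<^sup>2)\<close>.
\<close>

lemma sphere_tail_0_asymp:
  "(\<lambda>n. sqrt (real n) * sphere_tail n 0) \<longlonglongrightarrow> sqrt (pi / 2)"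
proof -
  define a where "a n = real n / 2 - 2" for n :: nat
  define g where "g n v = indicator {0..sqrt (a n)} v * (1 - v\<^sup>2 / a n) powr (a n)" for n and v :: real
  have a_top: "filterlim a at_top sequentially" unfolding a_def by real_asymp
  have lim: "(\<lambda>n. \<integral>v. g n v \<partial>lborel) \<longlonglongrightarrow> (\<integral>v. indicator {0..} v *\<^sub>R exp (- v\<^sup>2) \<partial>lborel)"
  proof (rule integral_dominated_convergence)
    show "integrable lborel (\<lambda>x::real. indicator {0..} x *\<^sub>R exp (- x\<^sup>2))"
      using gaussian_moment_0 by (rule integrable.intros)
    show "(\<lambda>v::real. indicator {0..} v *\<^sub>R exp (- v\<^sup>2)) \<in> borel_measurable lborel"
      by measurable
    show "(\<lambda>x. g n x) \<in> borel_measurable lborel" for n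
      unfolding g_def by measurable
    show "AE x in lborel. (\<lambda>n. g n x) \<longlonglongrightarrow> indicator {0..} x *\<^sub>R exp (- x\<^sup>2)"
    proof (rule AE_I2)
      fix x :: real
      show "(\<lambda>n. g n x) \<longlonglongrightarrow> indicator {0..} x *\<^sub>R exp (- x\<^sup>2)"
      proof (cases "x \<ge> 0")
        case True
        have "(\<lambda>n. (1 + (- x\<^sup>2) / a n) powr (a n)) \<longlonglongrightarrow> exp (- x\<^sup>2)"
          by (rule filterlim_compose[OF tendsto_exp_limit_at_top a_top])
        moreover have "\<forall>\<^sub>F n in sequentially. (1 + (- x\<^sup>2) / a n) powr (a n) = g n x"
          using a_top[unfolded filterlim_at_top, rule_format, of "x\<^sup>2"]
        proof eventually_elim
          case (elim n)
          then have "x \<le> sqrt (a n)" using True by (simp add: real_le_rsqrt)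
          then show ?case using True by (simp add: g_def)
        qed
        ultimately have "(\<lambda>n. g n x) \<longlonglongrightarrow> exp (- x\<^sup>2)" by (rule Lim_transform_eventually)
        then show ?thesis using True by simp
      qed (simp add: g_def)
    qed
    show "AE x in lborel. norm (g n x) \<le> indicator {0..} x *\<^sub>R exp (- x\<^sup>2)" for n
    proof (rule AE_I2)
      fix x :: real
      show "norm (g n x) \<le> indicator {0..} x *\<^sub>R exp (- x\<^sup>2)"
      proof (cases "0 \<le> x \<and> x \<le> sqrt (a n)")
        case True
        then have an: "a n \<ge> 0" by (metis order_trans real_sqrt_ge_0_iff)
        with True have "x\<^sup>2 \<le> a n" by (metis power_mono real_sqrt_pow2)
        then have z: "0 \<le> 1 - x\<^sup>2 / a n" using an by (cases "a n = 0") (auto simp: field_simps)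
        have "(1 - x\<^sup>2 / a n) powr (a n) \<le> exp (- x\<^sup>2 / a n) powr (a n)"
          using exp_ge_add_one_self[of "- x\<^sup>2 / a n"] z an by (intro powr_mono2) auto
        also have "\<dots> = exp (- x\<^sup>2)" using \<open>x\<^sup>2 \<le> a n\<close> by (cases "a n = 0") (auto simp: powr_def)
        finally show ?thesis using True by (simp add: g_def)
      qed (auto simp: g_def)
    qed
  qed
  have val: "integral\<^sup>L lborel (\<lambda>v::real. indicator {0..} v *\<^sub>R exp (- v\<^sup>2)) = sqrt pi / 2"
    using gaussian_moment_0 by (rule has_bochner_integral_integral_eq)
  have eq: "(\<integral>v. g n v \<partial>lborel) = sqrt (a n) * sphere_tail n 0" if n: "n \<ge> 5" for n
  proof -
    have an: "a n > 0" using n by (simp add: a_def)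
    have "(\<integral>v. g n v \<partial>lborel) = sqrt (a n) * (\<integral>r. g n (0 + sqrt (a n) * r) \<partial>lborel)"
      using an by (subst lborel_integral_real_affine[where c="sqrt (a n)" and t=0]) auto
    also have "(\<lambda>r. g n (0 + sqrt (a n) * r)) = (\<lambda>r. indicator {0..1} r *\<^sub>R sphere_weight n r)"
      using an by (auto simp: g_def sphere_weight_def a_def indicator_def fun_eq_iff power_mult_distrib
          zero_le_mult_iff mult_le_cancel_left1)
    also have "(\<integral>r. indicator {0..1} r *\<^sub>R sphere_weight n r \<partial>lborel) = integral {0..1} (sphere_weight n)"
      using set_borel_integral_eq_integral(2)[OF borel_integrable_atLeastAtMost'[OF continuous_on_sphere_weight[OF n, of "{0..1}"]]]
      by (simp add: set_lebesgue_integral_def)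
    finally show ?thesis by (simp add: sphere_tail_def)
  qed
  have "(\<lambda>n. sqrt (real n / a n) * (\<integral>v. g n v \<partial>lborel)) \<longlonglongrightarrow> sqrt 2 * (sqrt pi / 2)"
  proof (intro tendsto_mult tendsto_real_sqrt)
    show "(\<lambda>n. real n / a n) \<longlonglongrightarrow> 2" unfolding a_def by real_asymp
    show "(\<lambda>n. \<integral>v. g n v \<partial>lborel) \<longlonglongrightarrow> sqrt pi / 2" using lim unfolding val .
  qed
  moreover have "\<forall>\<^sub>F n in sequentially. sqrt (real n / a n) * (\<integral>v. g n v \<partial>lborel) = sqrt (real n) * sphere_tail n 0"
    using eventually_ge_at_top[of 5]
    by eventually_elim (simp add: eq real_sqrt_divide a_def)
  ultimately have "(\<lambda>n. sqrt (real n) * sphere_tail n 0) \<longlonglongrightarrow> sqrt 2 * (sqrt pi / 2)"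
    by (rule Lim_transform_eventually)
  also have "sqrt 2 * (sqrt pi / 2) = sqrt (pi / 2)"
    by (simp add: real_sqrt_divide field_simps)
  finally show ?thesis .
qed

text \<open>
  Write \<open>L = ln p\<close>, \<open>x = v / n = t\<^sup>2\<close> and \<open>b = n / 2 - 1\<close>. By the bounds above, \<open>q\<close> is asymptotic to
  \<open>(1 - x) powr b\<close> divided by \<open>sqrt x * (n - 2) * sphere_tail n 0\<close>, a divisor asymptotic to
  \<open>sqrt v * sqrt (\<pi> / 2)\<close> and hence to \<open>sqrt (2 \<pi> L)\<close>. For the power,
  \<open>b ln (1 - x) = - v / 2 - b x\<^sup>2 / 2 + o(1)\<close> with \<open>b x\<^sup>2\<close> tending to \<open>8 \<alpha>\<^sup>2\<close>. The terms \<open>4 L - ln L\<close> of \<open>v\<close> are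
  chosen so that \<open>exp (- v / 2)\<close> contributes \<open>sqrt L / p\<^sup>2\<close>, cancelling \<open>p\<^sup>2\<close> and \<open>sqrt L\<close>.
\<close>

lemma scaled_tail_limit:
  fixes p :: "nat \<Rightarrow> nat" and \<alpha> y :: real
  assumes p: "filterlim p at_top sequentially"
    and growth: "(\<lambda>n. ln (real (p n)) / sqrt (real n)) \<longlonglongrightarrow> \<alpha>"
  defines "v \<equiv> \<lambda>n. y + 4 * ln (real (p n)) - ln (ln (real (p n)))"
  shows "\<forall>\<^sub>F n in sequentially. 0 < v n \<and> v n < real n"
    and "(\<lambda>n. real (p n) ^ 2 * (sphere_tail n (sqrt (v n / real n)) / sphere_tail n 0))
       \<longlonglongrightarrow> exp (- (y + 8 * \<alpha>\<^sup>2) / 2) / sqrt (2 * pi)"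
proof -
  define L where "L n = ln (real (p n))" for n
  have rp: "filterlim (\<lambda>n. real (p n)) at_top sequentially"
    using p by (rule filterlim_compose[OF filterlim_real_sequentially])
  have L_top: "filterlim L at_top sequentially"
    unfolding L_def by (rule filterlim_compose[OF ln_at_top rp])
  have v: "v n = y + 4 * L n - ln (L n)" for n by (simp add: v_def L_def)
  have ratio: "(\<lambda>n. v n / L n) \<longlonglongrightarrow> 4"
    unfolding v by (rule filterlim_compose[OF _ L_top]) real_asymp
  have v_top: "filterlim v at_top sequentially"
    unfolding v by (rule filterlim_compose[OF _ L_top]) real_asymp
  have Lev: "\<forall>\<^sub>F n in sequentially. L n > 1"
    using L_top by (simp add: filterlim_at_top_dense)
  have vs: "(\<lambda>n. v n / sqrt (real n)) \<longlonglongrightarrow> 4 * \<alpha>"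
  proof -
    have "(\<lambda>n. (v n / L n) * (L n / sqrt (real n))) \<longlonglongrightarrow> 4 * \<alpha>"
      using growth unfolding L_def[symmetric] by (intro tendsto_mult ratio)
    moreover have "\<forall>\<^sub>F n in sequentially. (v n / L n) * (L n / sqrt (real n)) = v n / sqrt (real n)"
      using Lev by eventually_elim simp
    ultimately show ?thesis by (rule Lim_transform_eventually)
  qed
  define x where "x n = v n / real n" for n
  have x0: "x \<longlonglongrightarrow> 0"
  proof -
    have "(\<lambda>n. (v n / sqrt (real n)) * (1 / sqrt (real n))) \<longlonglongrightarrow> 4 * \<alpha> * 0"
      by (intro tendsto_mult vs) real_asymp
    then show ?thesis unfolding x_def by (simp add: field_simps)
  qed
  have n_pos: "\<forall>\<^sub>F n in sequentially. n \<ge> 5" by (rule eventually_ge_at_top)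
  have vpos: "\<forall>\<^sub>F n in sequentially. v n > 0"
    using v_top by (simp add: filterlim_at_top_dense)
  have xlt: "\<forall>\<^sub>F n in sequentially. x n < 1" using x0 by (rule order_tendstoD) simp
  have x_ev: "\<forall>\<^sub>F n in sequentially. 0 < x n \<and> x n < 1"
    using n_pos vpos xlt by eventually_elim (simp add: x_def)
  show "\<forall>\<^sub>F n in sequentially. 0 < v n \<and> v n < real n"
    using n_pos vpos xlt by eventually_elim (simp add: x_def)
  define b where "b n = real n / 2 - 1" for n
  have bx2: "(\<lambda>n. b n * (x n)\<^sup>2) \<longlonglongrightarrow> 8 * \<alpha>\<^sup>2"
  proof -
    have "(\<lambda>n. (b n / real n) * (v n / sqrt (real n))\<^sup>2) \<longlonglongrightarrow> (1/2) * (4 * \<alpha>)\<^sup>2"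
      by (intro tendsto_mult tendsto_power vs) (unfold b_def, real_asymp)
    also have "(1/2) * (4 * \<alpha>)\<^sup>2 = 8 * \<alpha>\<^sup>2" by (simp add: power_mult_distrib)
    finally have "(\<lambda>n. (b n / real n) * (v n / sqrt (real n))\<^sup>2) \<longlonglongrightarrow> 8 * \<alpha>\<^sup>2" .
    moreover have "\<forall>\<^sub>F n in sequentially. (b n / real n) * (v n / sqrt (real n))\<^sup>2 = b n * (x n)\<^sup>2"
      using n_pos by eventually_elim (simp add: x_def power2_eq_square)
    ultimately show ?thesis by (rule Lim_transform_eventually)
  qed
  have rem: "(\<lambda>n. (ln (1 - x n) + x n) / (x n)\<^sup>2) \<longlonglongrightarrow> - 1 / 2"
  proof -
    have "((\<lambda>z::real. (ln (1 - z) + z) / z\<^sup>2) \<longlongrightarrow> - 1 / 2) (at_right 0)" by real_asymp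
    moreover have "filterlim x (at_right 0) sequentially"
      unfolding filterlim_at using x0 x_ev by (auto elim: eventually_mono)
    ultimately show ?thesis by (rule filterlim_compose)
  qed
  have expo: "(\<lambda>n. b n * ln (1 - x n) + 2 * L n - ln (L n) / 2) \<longlonglongrightarrow> - y / 2 - 4 * \<alpha>\<^sup>2"
  proof -
    have "(\<lambda>n. b n * (x n)\<^sup>2 * ((ln (1 - x n) + x n) / (x n)\<^sup>2) + x n - y / 2)
        \<longlonglongrightarrow> 8 * \<alpha>\<^sup>2 * (- 1 / 2) + 0 - y / 2"
      by (intro tendsto_intros bx2 rem x0)
    also have "8 * \<alpha>\<^sup>2 * (- 1 / 2) + 0 - y / 2 = - y / 2 - 4 * \<alpha>\<^sup>2" by simp
    finally have "(\<lambda>n. b n * (x n)\<^sup>2 * ((ln (1 - x n) + x n) / (x n)\<^sup>2) + x n - y / 2)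
        \<longlonglongrightarrow> - y / 2 - 4 * \<alpha>\<^sup>2" .
    moreover have "\<forall>\<^sub>F n in sequentially. b n * (x n)\<^sup>2 * ((ln (1 - x n) + x n) / (x n)\<^sup>2) + x n - y / 2
        = b n * ln (1 - x n) + 2 * L n - ln (L n) / 2"
      using x_ev n_pos
    proof eventually_elim
      case (elim n)
      have "b n * x n = v n / 2 - x n" using elim by (simp add: b_def x_def field_simps)
      moreover have "b n * (x n)\<^sup>2 * ((ln (1 - x n) + x n) / (x n)\<^sup>2) = b n * ln (1 - x n) + b n * x n"
        using elim by (simp add: field_simps power2_eq_square)
      ultimately show ?case by (simp add: v diff_divide_distrib add_divide_distrib)
    qed
    ultimately show ?thesis by (rule Lim_transform_eventually)
  qed
  define B where "B n = (1 - x n) powr (b n) / sqrt (x n)" for n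
  have main: "(\<lambda>n. real (p n) ^ 2 * (B n / (real n - 2) / sphere_tail n 0))
      \<longlonglongrightarrow> exp (- (y + 8 * \<alpha>\<^sup>2) / 2) / sqrt (2 * pi)"
  proof -
    have "(\<lambda>n. exp (b n * ln (1 - x n) + 2 * L n - ln (L n) / 2) * (1 / sqrt (v n / L n))
          * (real n / (real n - 2)) * (1 / (sqrt (real n) * sphere_tail n 0)))
        \<longlonglongrightarrow> exp (- y / 2 - 4 * \<alpha>\<^sup>2) * (1 / sqrt 4) * 1 * (1 / sqrt (pi / 2))"
      by (intro tendsto_mult tendsto_exp expo tendsto_divide tendsto_const tendsto_real_sqrt ratio
          sphere_tail_0_asymp) (auto, real_asymp)
    also have "exp (- y / 2 - 4 * \<alpha>\<^sup>2) * (1 / sqrt 4) * 1 * (1 / sqrt (pi / 2))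
        = exp (- (y + 8 * \<alpha>\<^sup>2) / 2) / sqrt (2 * pi)"
      by (simp add: real_sqrt_divide real_sqrt_mult field_simps)
    finally have "(\<lambda>n. exp (b n * ln (1 - x n) + 2 * L n - ln (L n) / 2) * (1 / sqrt (v n / L n))
          * (real n / (real n - 2)) * (1 / (sqrt (real n) * sphere_tail n 0)))
        \<longlonglongrightarrow> exp (- (y + 8 * \<alpha>\<^sup>2) / 2) / sqrt (2 * pi)" .
    moreover have "\<forall>\<^sub>F n in sequentially. exp (b n * ln (1 - x n) + 2 * L n - ln (L n) / 2) * (1 / sqrt (v n / L n))
          * (real n / (real n - 2)) * (1 / (sqrt (real n) * sphere_tail n 0))
        = real (p n) ^ 2 * (B n / (real n - 2) / sphere_tail n 0)"
      using x_ev n_pos vpos Lev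
    proof eventually_elim
      case (elim n)
      have pp: "real (p n) > 0" using elim(4) by (cases "p n = 0") (auto simp: L_def)
      have "exp (2 * L n) = (exp (L n))\<^sup>2" by (simp add: exp_double)
      also have "exp (L n) = real (p n)" using pp by (simp add: L_def)
      finally have e1: "exp (2 * L n) = (real (p n))\<^sup>2" .
      have e2: "exp (ln (L n) / 2) = sqrt (L n)"
        using elim(4) by (simp add: powr_half_sqrt[symmetric] powr_def)
      have e3: "exp (b n * ln (1 - x n)) = (1 - x n) powr (b n)" using elim by (simp add: powr_def)
      have e: "exp (b n * ln (1 - x n) + 2 * L n - ln (L n) / 2)
          = (1 - x n) powr (b n) * (real (p n))\<^sup>2 / sqrt (L n)"
        by (simp add: exp_add exp_diff e1 e2 e3)
      have alg: "A * P / l * (1 / (w / l)) * (s * s / m) * (1 / (s * J)) = P * (A / (w / s) / m / J)"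
        if "l \<noteq> 0" "s \<noteq> 0" for A P l w s m J :: real
        using that by (simp add: field_simps)
      have "sqrt (real n) * sqrt (real n) = real n" by simp
      with alg[of "sqrt (L n)" "sqrt (real n)" "(1 - x n) powr (b n)" "(real (p n))\<^sup>2" "sqrt (v n)"
          "real n - 2" "sphere_tail n 0"]
      show ?case using elim unfolding e B_def
        by (simp only: x_def real_sqrt_divide) simp
    qed
    ultimately show ?thesis by (rule Lim_transform_eventually)
  qed
  \<comment> \<open>The lower and the upper bound for the tail differ by this factor.\<close>
  have corr: "(\<lambda>n. (real n - 2) / (real n - 2 + 1 / x n)) \<longlonglongrightarrow> 1"
  proof -
    have "(\<lambda>n. inverse (v n)) \<longlonglongrightarrow> 0" by (rule tendsto_inverse_0_at_top[OF v_top])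
    then have "(\<lambda>n. 1 / (1 + (real n / (real n - 2)) * inverse (v n))) \<longlonglongrightarrow> 1 / (1 + 1 * 0)"
      by (intro tendsto_intros) (auto, real_asymp)
    moreover have "\<forall>\<^sub>F n in sequentially. 1 / (1 + (real n / (real n - 2)) * inverse (v n))
        = (real n - 2) / (real n - 2 + 1 / x n)"
      using n_pos vpos
    proof eventually_elim
      case (elim n)
      have "m / (m + c / w) = 1 / (1 + (c / m) * inverse w)" if "m > 0" "w > 0" "c > 0" for m c w :: real
        using that by (simp add: field_simps)
      from this[of "real n - 2" "v n" "real n"] show ?case using elim by (simp add: x_def)
    qed
    ultimately have "(\<lambda>n. (real n - 2) / (real n - 2 + 1 / x n)) \<longlonglongrightarrow> 1 / (1 + 1 * 0)"
      by (rule Lim_transform_eventually)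
    then show ?thesis by simp
  qed
  have tail0: "\<forall>\<^sub>F n in sequentially. sphere_tail n 0 > 0"
  proof -
    have "\<forall>\<^sub>F n in sequentially. sqrt (real n) * sphere_tail n 0 > 0"
      using sphere_tail_0_asymp by (rule order_tendstoD) simp
    then show ?thesis using n_pos by eventually_elim (simp add: zero_less_mult_iff)
  qed
  show "(\<lambda>n. real (p n) ^ 2 * (sphere_tail n (sqrt (v n / real n)) / sphere_tail n 0))
       \<longlonglongrightarrow> exp (- (y + 8 * \<alpha>\<^sup>2) / 2) / sqrt (2 * pi)"
  proof (rule tendsto_sandwich[OF _ _ _ main])
    show "(\<lambda>n. (real (p n) ^ 2 * (B n / (real n - 2) / sphere_tail n 0)) * ((real n - 2) / (real n - 2 + 1 / x n)))
        \<longlonglongrightarrow> exp (- (y + 8 * \<alpha>\<^sup>2) / 2) / sqrt (2 * pi)"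
      using tendsto_mult[OF main corr] by simp
    have bounds: "\<forall>\<^sub>F n in sequentially. B n / (real n - 2 + 1 / x n) \<le> sphere_tail n (sqrt (x n))
        \<and> sphere_tail n (sqrt (x n)) \<le> B n / (real n - 2)"
      using x_ev n_pos
    proof eventually_elim
      case (elim n)
      then show ?case
        using sphere_tail_bounds[of n "sqrt (x n)"] by (simp add: B_def b_def)
    qed
    show "\<forall>\<^sub>F n in sequentially. (real (p n) ^ 2 * (B n / (real n - 2) / sphere_tail n 0)) * ((real n - 2) / (real n - 2 + 1 / x n))
        \<le> real (p n) ^ 2 * (sphere_tail n (sqrt (v n / real n)) / sphere_tail n 0)"
      using bounds tail0 n_pos
    proof eventually_elim
      case (elim n)
      have "(real (p n) ^ 2 * (B n / (real n - 2) / sphere_tail n 0)) * ((real n - 2) / (real n - 2 + 1 / x n))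
          = real (p n) ^ 2 * (B n / (real n - 2 + 1 / x n) / sphere_tail n 0)"
        using elim by simp
      also have "\<dots> \<le> real (p n) ^ 2 * (sphere_tail n (sqrt (x n)) / sphere_tail n 0)"
        using elim by (intro mult_left_mono divide_right_mono) auto
      finally show ?case by (simp add: x_def)
    qed
    show "\<forall>\<^sub>F n in sequentially. real (p n) ^ 2 * (sphere_tail n (sqrt (v n / real n)) / sphere_tail n 0)
        \<le> real (p n) ^ 2 * (B n / (real n - 2) / sphere_tail n 0)"
      using bounds tail0
    proof eventually_elim
      case (elim n)
      then show ?case unfolding x_def by (intro mult_left_mono divide_right_mono) auto
    qed
  qed
qed

section \<open>The law of a coordinate on the sphere\<close>

lemma sphere_tail_0_pos:
  assumes n: "n \<ge> 5" shows "sphere_tail n 0 > 0"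
proof -
  have "0 < ((1 - (1/2)\<^sup>2) powr (real n / 2 - 1) / (1/2)) / (real n - 2 + 1 / (1/2)\<^sup>2)"
    using n by (auto simp: power2_eq_square)
  also have "\<dots> \<le> sphere_tail n (1/2)" by (rule sphere_tail_bounds(1)[OF n]) auto
  also have "\<dots> \<le> sphere_tail n 0"
    unfolding sphere_tail_def using n
    by (intro integral_subset_le integrable_continuous_real continuous_on_sphere_weight) auto
  finally show ?thesis .
qed

lemma integral_sphere_weight_minus:
  "integral {- b..- a} (sphere_weight n) = integral {a..b} (sphere_weight n)"
  using Henstock_Kurzweil_Integration.integral_reflect_real[of b a "sphere_weight n"] by simp

definition sphere_law :: "nat \<Rightarrow> real measure" where
  "sphere_law n = density lborel
     (\<lambda>r. ennreal (indicator {-1..1} r * sphere_weight n r / (2 * sphere_tail n 0)))"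

lemma sphere_weight_measurable [measurable]: "sphere_weight n \<in> borel_measurable borel"
  unfolding sphere_weight_def by measurable

text \<open>
  This moves between the Lebesgue integral in the law and the Henstock-Kurzweil integral in which
  the tail and the moments of the weight are computed.
\<close>

lemma integral_sphere_law:
  assumes n: "n \<ge> 5" and f: "continuous_on {-1..1} f" "f \<in> borel_measurable borel"
  shows "(\<integral>r. f r \<partial>sphere_law n) = integral {-1..1} (\<lambda>r. f r * sphere_weight n r) / (2 * sphere_tail n 0)"
proof -
  have "(\<integral>r. f r \<partial>sphere_law n)
      = (\<integral>r. (indicator {-1..1} r * sphere_weight n r / (2 * sphere_tail n 0)) *\<^sub>R f r \<partial>lborel)"
    unfolding sphere_law_def
    using f sphere_tail_0_pos[OF n] by (intro integral_density) (auto intro!: AE_I2)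
  also have "\<dots> = (\<integral>r. (indicator {-1..1} r *\<^sub>R (f r * sphere_weight n r)) / (2 * sphere_tail n 0) \<partial>lborel)"
    by (intro Bochner_Integration.integral_cong) auto
  also have "\<dots> = integral {-1..1} (\<lambda>r. f r * sphere_weight n r) / (2 * sphere_tail n 0)"
  proof -
    have "set_integrable lborel {-1..1} (\<lambda>r. f r * sphere_weight n r)"
      using f n by (intro borel_integrable_atLeastAtMost' continuous_intros continuous_on_sphere_weight) auto
    then show ?thesis
      using set_borel_integral_eq_integral(2)
      unfolding set_lebesgue_integral_def integral_divide_zero by metis
  qed
  finally show ?thesis .
qed

lemma integral_sphere_weight_symmetric:
  assumes n: "n \<ge> 5" and t: "0 \<le> t" "t \<le> 1"
  shows "integral {-t..t} (sphere_weight n) = 2 * (sphere_tail n 0 - sphere_tail n t)"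
proof -
  have i: "sphere_weight n integrable_on {a..b}" if "-1 \<le> a" "b \<le> 1" for a b
    using that n by (intro integrable_continuous_real continuous_on_sphere_weight) auto
  have "integral {-t..t} (sphere_weight n) = integral {-t..0} (sphere_weight n) + integral {0..t} (sphere_weight n)"
    using t by (intro Henstock_Kurzweil_Integration.integral_combine[symmetric] i) auto
  also have "integral {-t..0} (sphere_weight n) = integral {0..t} (sphere_weight n)"
    using integral_sphere_weight_minus[of t 0 n] by simp
  also have "integral {0..t} (sphere_weight n) = sphere_tail n 0 - sphere_tail n t"
    using Henstock_Kurzweil_Integration.integral_combine[OF t(1) t(2) i] by (simp add: sphere_tail_def)
  finally show ?thesis by simp
qed

lemma emeasure_sphere_law_Icc:
  assumes n: "n \<ge> 5" and t: "0 \<le> t" "t \<le> 1"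
  shows "emeasure (sphere_law n) {-t..t} = ennreal ((sphere_tail n 0 - sphere_tail n t) / sphere_tail n 0)"
proof -
  let ?J = "sphere_tail n 0"
  have "emeasure (sphere_law n) {-t..t}
      = (\<integral>\<^sup>+ r. ennreal (indicator {-1..1} r * sphere_weight n r / (2 * ?J)) * indicator {-t..t} r \<partial>lborel)"
    unfolding sphere_law_def by (rule emeasure_density) measurable
  also have "\<dots> = (\<integral>\<^sup>+ r. ennreal (sphere_weight n r / (2 * ?J)) * indicator {-t..t} r \<partial>lborel)"
    using t by (intro nn_integral_cong) (auto simp: indicator_def)
  also have "\<dots> = ennreal (integral {-t..t} (sphere_weight n) / (2 * ?J))"
  proof (rule nn_integral_has_integral_lebesgue')
    have "(sphere_weight n has_integral integral {-t..t} (sphere_weight n)) {-t..t}"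
      using n t by (intro integrable_integral integrable_continuous_real continuous_on_sphere_weight) auto
    then show "((\<lambda>r. sphere_weight n r / (2 * ?J)) has_integral
        integral {-t..t} (sphere_weight n) / (2 * ?J)) {-t..t}"
      by (rule has_integral_divide)
  qed (use sphere_tail_0_pos[OF n] in auto)
  also have "integral {-t..t} (sphere_weight n) / (2 * ?J) = (?J - sphere_tail n t) / ?J"
    unfolding integral_sphere_weight_symmetric[OF n t] by (rule mult_divide_mult_cancel_left) simp
  finally show ?thesis .
qed

lemma emeasure_sphere_law_full:
  assumes n: "n \<ge> 5" shows "emeasure (sphere_law n) {-1..1} = 1"
  using emeasure_sphere_law_Icc[OF n, of 1] sphere_tail_0_pos[OF n]
  by (simp add: sphere_tail_def[of n 1])

lemma emeasure_sphere_law_UNIV: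
  assumes n: "n \<ge> 5" shows "emeasure (sphere_law n) UNIV = 1"
proof -
  have "emeasure (sphere_law n) UNIV = emeasure (sphere_law n) {-1..1}"
    unfolding sphere_law_def by (subst (1 2) emeasure_density) (auto intro!: nn_integral_cong simp: indicator_def)
  then show ?thesis using emeasure_sphere_law_full[OF n] by simp
qed

lemma real_distribution_sphere_law:
  assumes n: "n \<ge> 5" shows "real_distribution (sphere_law n)"
proof -
  interpret prob_space "sphere_law n"
    by (rule prob_spaceI) (use emeasure_sphere_law_UNIV[OF n] in \<open>simp add: sphere_law_def\<close>)
  show ?thesis by unfold_locales (simp_all add: sphere_law_def)
qed

lemma AE_sphere_law:
  assumes n: "n \<ge> 5" shows "AE x in sphere_law n. \<bar>x\<bar> \<le> 1"
proof -
  interpret real_distribution "sphere_law n" by (rule real_distribution_sphere_law[OF n])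
  have "prob {-1..1} = 1"
    using emeasure_sphere_law_full[OF n] by (simp add: measure_def)
  then have "AE x in sphere_law n. x \<in> {-1..1}" by (subst (asm) prob_eq_1) auto
  then show ?thesis by eventually_elim auto
qed

lemma sphere_law_moments:
  assumes n: "n \<ge> 5"
  shows "(2 * real k + 1) * (\<integral>x. x ^ (2 * k) \<partial>sphere_law n)
       = (2 * real k + real n - 1) * (\<integral>x. x ^ (2 * k + 2) \<partial>sphere_law n)"
    and "odd k \<Longrightarrow> (\<integral>x. x ^ k \<partial>sphere_law n) = 0"
proof -
  have m: "(\<integral>x. x ^ k \<partial>sphere_law n) = integral {-1..1} (\<lambda>r. r ^ k * sphere_weight n r) / (2 * sphere_tail n 0)" for k
    by (rule integral_sphere_law[OF n]) (auto intro!: continuous_intros)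
  show "(2 * real k + 1) * (\<integral>x. x ^ (2 * k) \<partial>sphere_law n)
       = (2 * real k + real n - 1) * (\<integral>x. x ^ (2 * k + 2) \<partial>sphere_law n)"
    unfolding m times_divide_eq_right sphere_weight_moments[OF n] ..
  show "odd k \<Longrightarrow> (\<integral>x. x ^ k \<partial>sphere_law n) = 0"
    unfolding m using sphere_weight_odd_moment[OF n] by simp
qed

lemma measure_sphere_law:
  assumes n: "n \<ge> 5" and t: "0 \<le> t" "t \<le> 1"
  shows "measure (sphere_law n) {r. t < \<bar>r\<bar>} = sphere_tail n t / sphere_tail n 0"
proof -
  interpret real_distribution "sphere_law n" by (rule real_distribution_sphere_law[OF n])
  have le: "sphere_tail n t \<le> sphere_tail n 0"
    unfolding sphere_tail_def using n t
    by (intro integral_subset_le integrable_continuous_real continuous_on_sphere_weight) auto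
  have "{r. t < \<bar>r\<bar>} = space (sphere_law n) - {-t..t}" by (auto simp: abs_le_iff not_le)
  then have "prob {r. t < \<bar>r\<bar>} = 1 - prob {-t..t}"
    using prob_compl[of "{-t..t}"] by simp
  also have "prob {-t..t} = (sphere_tail n 0 - sphere_tail n t) / sphere_tail n 0"
    unfolding measure_def emeasure_sphere_law_Icc[OF n t] using le sphere_tail_0_pos[OF n] by simp
  also have "1 - \<dots> = sphere_tail n t / sphere_tail n 0"
    using sphere_tail_0_pos[OF n] by (simp add: field_simps)
  finally show ?thesis .
qed

section \<open>Centred vectors and reflections\<close>

definition dotp :: "nat \<Rightarrow> (nat \<Rightarrow> real) \<Rightarrow> (nat \<Rightarrow> real) \<Rightarrow> real" where
  "dotp n x y = (\<Sum>i=1..n. x i * y i)"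

definition centred :: "nat \<Rightarrow> (nat \<Rightarrow> real) \<Rightarrow> nat \<Rightarrow> real" where
  "centred n x i = x i - mean n x"

definition spread :: "nat \<Rightarrow> (nat \<Rightarrow> real) \<Rightarrow> real" where
  "spread n x = sqrt (dotp n (centred n x) (centred n x))"

text \<open>
  The Householder matrix of the reflection in the hyperplane orthogonal to \<open>v\<close>. For \<open>v = 0\<close> the
  division by zero makes it the identity, so that the reflection along \<open>a - b\<close> carries \<open>a\<close> to \<open>b\<close> for
  all \<open>a\<close> and \<open>b\<close> of equal length, equal vectors included.
\<close>

definition reflection :: "nat \<Rightarrow> (nat \<Rightarrow> real) \<Rightarrow> nat \<Rightarrow> nat \<Rightarrow> real" where
  "reflection n v i j = (if i = j then 1 else 0) - 2 * v i * v j / dotp n v v"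

lemma dotp_commute: "dotp n x y = dotp n y x"
  by (simp add: dotp_def mult.commute)

lemma dotp_add_right: "dotp n x (\<lambda>i. a i + b i) = dotp n x a + dotp n x b"
  by (simp add: dotp_def algebra_simps sum.distrib)

lemma dotp_diff_right: "dotp n x (\<lambda>i. a i - b i) = dotp n x a - dotp n x b"
  by (simp add: dotp_def algebra_simps sum_subtractf)

lemma dotp_scale_right: "dotp n x (\<lambda>i. c * a i) = c * dotp n x a"
  by (simp add: dotp_def sum_distrib_left algebra_simps)

lemma dotp_self_nonneg: "0 \<le> dotp n x x"
  by (simp add: dotp_def sum_nonneg)

lemma dotp_self_eq_0: "dotp n x x = 0 \<longleftrightarrow> (\<forall>i\<in>{1..n}. x i = 0)"
  by (simp add: dotp_def sum_nonneg_eq_0_iff)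

lemma dotp_cong: "(\<And>i. i \<in> {1..n} \<Longrightarrow> x i = x' i) \<Longrightarrow> (\<And>i. i \<in> {1..n} \<Longrightarrow> y i = y' i) \<Longrightarrow>
    dotp n x y = dotp n x' y'"
  by (simp add: dotp_def)

lemma dotp_Cauchy_Schwarz: "\<bar>dotp n x y\<bar> \<le> sqrt (dotp n x x) * sqrt (dotp n y y)"
proof -
  have "(dotp n x y)\<^sup>2 \<le> dotp n x x * dotp n y y"
    using Cauchy_Schwarz_ineq_sum[of x y "{1..n}"] by (simp add: dotp_def power2_eq_square)
  then show ?thesis by (simp add: real_sqrt_mult[symmetric] real_le_rsqrt)
qed

lemma spread_nonneg [simp]: "0 \<le> spread n x"
  by (simp add: spread_def dotp_self_nonneg)

lemma sum_centred [simp]: "n \<ge> 1 \<Longrightarrow> (\<Sum>i=1..n. centred n x i) = 0"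
  unfolding centred_def mean_def by (simp add: sum_subtractf)

lemma dotp_centred_left: "(\<Sum>i=1..n. a i) = 0 \<Longrightarrow> dotp n (centred n x) a = dotp n x a"
  by (simp add: dotp_def centred_def left_diff_distrib sum_subtractf sum_distrib_left[symmetric])

lemma spread_power2: "n \<ge> 1 \<Longrightarrow> (spread n x)\<^sup>2 = dotp n x x - (\<Sum>i=1..n. x i)\<^sup>2 / real n"
proof -
  assume n: "n \<ge> 1"
  have "(spread n x)\<^sup>2 = dotp n (centred n x) (centred n x)"
    by (simp add: spread_def dotp_self_nonneg)
  also have "\<dots> = dotp n x (centred n x)" by (intro dotp_centred_left sum_centred n)
  also have "\<dots> = dotp n x x - (\<Sum>i=1..n. x i) * mean n x"
    by (simp add: dotp_def centred_def algebra_simps sum_subtractf sum_distrib_left)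
  finally show ?thesis by (simp add: mean_def power2_eq_square)
qed

lemma spread_eq_0: "spread n x = 0 \<longleftrightarrow> (\<forall>i\<in>{1..n}. x i = mean n x)"
  by (simp add: spread_def dotp_self_eq_0 centred_def)

lemma dotp_le_spread:
  assumes "(\<Sum>i=1..n. a i) = 0"
  shows "\<bar>dotp n x a\<bar> \<le> spread n x * sqrt (dotp n a a)"
  using dotp_Cauchy_Schwarz[of n "centred n x" a] dotp_centred_left[OF assms, of x]
  by (simp add: spread_def)

text \<open>
  The correlation is the inner product of \<open>x\<close> with a centred unit vector (if \<open>y\<close> is not constant),
  divided by the length of the centred part of \<open>x\<close>. This form also holds for constant \<open>x\<close> or \<open>y\<close>,
  where both sides are \<open>0\<close>.
\<close>

lemma pearson_altdef:
  assumes "n \<ge> 1"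
  shows "pearson n x y = dotp n x (\<lambda>i. inverse (spread n y) * centred n y i) / spread n x"
proof -
  have "pearson n x y = dotp n (centred n x) (centred n y) / (spread n x * spread n y)"
    by (simp add: pearson_def dotp_def centred_def spread_def power2_eq_square real_sqrt_mult)
  then show ?thesis
    using assms dotp_centred_left[OF sum_centred[OF assms]]
    unfolding dotp_scale_right by (simp add: field_simps)
qed

lemma reflection_apply:
  assumes "i \<in> {1..n}"
  shows "matrix_vec n (reflection n v) x i = x i - 2 * dotp n v x / dotp n v v * v i"
proof -
  have "matrix_vec n (reflection n v) x i
      = (\<Sum>j=1..n. (if i = j then x j else 0) - 2 * v i / dotp n v v * (v j * x j))"
    using assms by (auto simp: matrix_vec_def reflection_def algebra_simps intro!: sum.cong)
  also have "\<dots> = x i - 2 * v i / dotp n v v * dotp n v x"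
    using assms unfolding sum_subtractf sum_distrib_left[symmetric] dotp_def[of n v x] by simp
  finally show ?thesis by (simp add: mult_ac)
qed

lemma orthogonal_reflection: "orthogonal_mat n (reflection n v)"
  unfolding orthogonal_mat_def
proof (intro ballI)
  fix i j assume ij: "i \<in> {1..n}" "j \<in> {1..n}"
  let ?c = "2 / dotp n v v"
  have "(\<Sum>k=1..n. reflection n v k i * reflection n v k j)
      = (\<Sum>k=1..n. (if k = i then (if i = j then 1 else 0) else 0) - (if k = j then ?c * v i * v j else 0)
          - (if k = i then ?c * v i * v j else 0) + ?c\<^sup>2 * v i * v j * (v k * v k))"
    by (intro sum.cong) (auto simp: reflection_def algebra_simps power2_eq_square)
  also have "\<dots> = (if i = j then 1 else 0) - 2 * ?c * v i * v j + ?c\<^sup>2 * v i * v j * dotp n v v"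
    using ij by (simp add: sum.distrib sum_subtractf sum_distrib_left[symmetric] dotp_def)
  also have "\<dots> = (if i = j then 1 else 0)"
    by (simp add: power2_eq_square)
  finally show "(\<Sum>k=1..n. reflection n v k i * reflection n v k j) = (if i = j then 1 else 0)" .
qed

lemma dotp_reflection:
  "dotp n (matrix_vec n (reflection n v) x) a = dotp n x a - 2 * dotp n v a / dotp n v v * dotp n v x"
proof -
  have "dotp n (matrix_vec n (reflection n v) x) a
      = (\<Sum>i=1..n. x i * a i - 2 * dotp n v x / dotp n v v * (v i * a i))"
    unfolding dotp_def[of n "matrix_vec n (reflection n v) x"]
    by (intro sum.cong) (simp_all add: reflection_apply algebra_simps)
  also have "\<dots> = dotp n x a - 2 * dotp n v x / dotp n v v * dotp n v a"
    unfolding sum_subtractf sum_distrib_left[symmetric] dotp_def[of n x a] dotp_def[of n v a] ..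
  finally show ?thesis by simp
qed

text \<open>
  For \<open>a\<close> and \<open>b\<close> of equal length, \<open>a - b\<close> has squared length \<open>2 \<langle>a - b, a\<rangle>\<close>; this is why the
  reflection along \<open>a - b\<close> exchanges \<open>a\<close> and \<open>b\<close>.
\<close>

lemma dotp_difference_ratio:
  assumes "dotp n a a = dotp n b b" and v: "v = (\<lambda>i. a i - b i)" and "dotp n v v \<noteq> 0"
  shows "2 * dotp n v a / dotp n v v = 1"
proof -
  have "dotp n v v = 2 * dotp n v a"
    using assms(1) unfolding v
    by (simp add: dotp_diff_right dotp_commute[of n "\<lambda>i. a i - b i"] dotp_commute[of n b a])
  then show ?thesis using assms(3) by simp
qed

lemma dotp_reflection_swap:
  assumes "dotp n a a = dotp n b b"
  shows "dotp n (matrix_vec n (reflection n (\<lambda>i. a i - b i)) x) a = dotp n x b"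
proof (cases "dotp n (\<lambda>i. a i - b i) (\<lambda>i. a i - b i) = 0")
  case True
  then have "dotp n x a = dotp n x b" by (intro dotp_cong) (auto simp: dotp_self_eq_0)
  then show ?thesis using True by (simp add: dotp_reflection)
next
  case False
  have "dotp n (matrix_vec n (reflection n (\<lambda>i. a i - b i)) x) a = dotp n x a - 1 * dotp n (\<lambda>i. a i - b i) x"
    unfolding dotp_reflection using dotp_difference_ratio[OF assms refl False] by simp
  then show ?thesis by (simp add: dotp_commute[of n _ x] dotp_diff_right)
qed

lemma reflection_swap:
  assumes "dotp n a a = dotp n b b" "i \<in> {1..n}" "\<And>j. j \<in> {1..n} \<Longrightarrow> x j = s * a j"
  shows "matrix_vec n (reflection n (\<lambda>i. a i - b i)) x i = s * b i"
proof -
  let ?v = "\<lambda>i. a i - b i"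
  have "dotp n ?v x = dotp n ?v (\<lambda>j. s * a j)" using assms(3) by (intro dotp_cong) auto
  also have "\<dots> = s * dotp n ?v a" by (rule dotp_scale_right)
  finally have x: "dotp n ?v x = s * dotp n ?v a" .
  show ?thesis
  proof (cases "dotp n ?v ?v = 0")
    case True
    then have "a i = b i" using assms(2) by (auto simp: dotp_self_eq_0)
    then show ?thesis using True assms by (simp add: reflection_apply)
  next
    case False
    have "2 * dotp n ?v x / dotp n ?v ?v = s * (2 * dotp n ?v a / dotp n ?v ?v)" by (simp add: x)
    also have "\<dots> = s" using dotp_difference_ratio[OF assms(1) refl False] by simp
    finally show ?thesis using assms by (simp add: reflection_apply algebra_simps)
  qed
qed

text \<open>
  A reflection along a centred vector fixes the constant vectors, hence preserves the mean as well as
  the length.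
\<close>

lemma spread_reflection:
  assumes "n \<ge> 1" "(\<Sum>i=1..n. v i) = 0"
  shows "spread n (matrix_vec n (reflection n v) x) = spread n x"
proof -
  let ?R = "matrix_vec n (reflection n v) x"
  have "(\<Sum>i=1..n. ?R i) = (\<Sum>i=1..n. x i - 2 * dotp n v x / dotp n v v * v i)"
    by (intro sum.cong refl reflection_apply)
  also have "\<dots> = (\<Sum>i=1..n. x i)"
    using assms unfolding sum_subtractf sum_distrib_left[symmetric] by simp
  finally have s: "(\<Sum>i=1..n. ?R i) = (\<Sum>i=1..n. x i)" .
  have "dotp n ?R ?R = dotp n x x"
  proof -
    have "dotp n ?R ?R = dotp n x ?R - 2 * dotp n v ?R / dotp n v v * dotp n v x"
      by (rule dotp_reflection)
    also have "dotp n x ?R = dotp n x x - 2 * dotp n v x / dotp n v v * dotp n v x"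
      by (subst dotp_commute, rule dotp_reflection)
    also have "dotp n v ?R = dotp n v x - 2 * dotp n v v / dotp n v v * dotp n v x"
      by (subst dotp_commute, subst dotp_reflection) (simp add: dotp_commute)
    finally show ?thesis by (cases "dotp n v v = 0") auto
  qed
  then have "(spread n ?R)\<^sup>2 = (spread n x)\<^sup>2"
    using assms(1) s by (simp add: spread_power2)
  then show ?thesis by (simp add: power2_eq_iff_nonneg)
qed

lemma dotp_measurable [measurable]: "(\<lambda>x. dotp n x a) \<in> borel_measurable (borel_vec n)"
  unfolding dotp_def by measurable

lemma spread_measurable [measurable]: "spread n \<in> borel_measurable (borel_vec n)"
  unfolding spread_def dotp_def centred_def mean_def by measurable

lemma matrix_vec_measurable [measurable]: "matrix_vec n A \<in> measurable (borel_vec n) (borel_vec n)"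
  unfolding matrix_vec_def by measurable

lemma pearson_measurable [measurable]:
  "(\<lambda>z. pearson n (fst z) (snd z)) \<in> borel_measurable (borel_vec n \<Otimes>\<^sub>M borel_vec n)"
  unfolding pearson_def mean_def by measurable

lemma pearson_commute: "pearson n x y = pearson n y x"
  by (simp add: pearson_def mult.commute)

section \<open>The correlation of a spherical vector with a fixed vector\<close>

text \<open>
  The Taylor polynomials of the characteristic function are given by the moments, and on \<open>[- 1, 1]\<close>
  their error is at most \<open>2 \<bar>t\<bar> ^ m / m!\<close>, which vanishes as the degree grows.
\<close>

lemma real_distribution_eq_of_moments:
  assumes P: "real_distribution P" and Q: "real_distribution Q"
    and P1: "AE x in P. \<bar>x\<bar> \<le> 1" and Q1: "AE x in Q. \<bar>x\<bar> \<le> 1"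
    and mom: "\<And>k. (\<integral>x. x ^ k \<partial>P) = (\<integral>x. x ^ k \<partial>Q)"
  shows "P = Q"
proof (rule Levy_uniqueness[OF P Q])
  have approx: "cmod (char R t - (\<Sum>k\<le>m. ((\<i> * t) ^ k / fact k) * (\<integral>x. x ^ k \<partial>R))) \<le> 2 * \<bar>t\<bar> ^ m / fact m"
    if R: "real_distribution R" and R1: "AE x in R. \<bar>x\<bar> \<le> 1" for R and t :: real and m
  proof -
    interpret R: real_distribution R by (rule R)
    have int: "integrable R (\<lambda>x. x ^ k)" for k
      by (rule R.integrable_const_bound[where B=1]) (use R1 in \<open>auto simp: power_abs power_le_one\<close>)
    have "integrable R (\<lambda>x. \<bar>x\<bar> ^ m)"
      using integrable_abs[OF int[of m]] by (simp add: power_abs)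
    then have "(\<integral>x. \<bar>x\<bar> ^ m \<partial>R) \<le> (\<integral>x. 1 \<partial>R)"
      by (rule integral_mono_AE) (use R1 in \<open>auto simp: power_le_one\<close>)
    moreover have "R.prob UNIV = 1" using R.prob_space by simp
    ultimately have e: "(\<integral>x. \<bar>x\<bar> ^ m \<partial>R) \<le> 1" by simp
    have "cmod (char R t - (\<Sum>k\<le>m. ((\<i> * t) ^ k / fact k) * (\<integral>x. x ^ k \<partial>R)))
        \<le> (2 * \<bar>t\<bar> ^ m / fact m) * (\<integral>x. \<bar>x\<bar> ^ m \<partial>R)"
      by (rule R.char_approx1) (rule int)
    also have "\<dots> \<le> (2 * \<bar>t\<bar> ^ m / fact m) * 1"
      by (intro mult_left_mono e) auto
    finally show ?thesis by simp
  qed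
  show "char P = char Q"
  proof
    fix t :: real
    have "cmod (char P t - char Q t) \<le> 4 * (\<bar>t\<bar> ^ m / fact m)" for m
      using norm_triangle_le_diff[OF add_mono[OF approx[OF P P1, of t m] approx[OF Q Q1, of t m]]]
      by (simp add: mom)
    moreover have "(\<lambda>m. 4 * (\<bar>t\<bar> ^ m / fact m)) \<longlonglongrightarrow> 4 * 0"
      using summable_LIMSEQ_zero[OF summable_exp[of "\<bar>t\<bar>"]]
      by (intro tendsto_mult tendsto_const) (simp add: divide_inverse mult.commute)
    ultimately have "cmod (char P t - char Q t) \<le> 4 * 0"
      by (intro tendsto_lowerbound[of "\<lambda>m. 4 * (\<bar>t\<bar> ^ m / fact m)"]) auto
    then show "char P t = char Q t" by simp
  qed
qed

lemma coeff_quadratic_power: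
  fixes a c :: real
  shows "coeff ([:1, a, c:] ^ m) 0 = 1"
    and "coeff ([:1, a, c:] ^ m) (Suc 0) = real m * a"
    and "coeff ([:1, a, c:] ^ m) 2 = real m * c + real m * (real m - 1) / 2 * a\<^sup>2"
proof -
  have rec: "coeff ([:1, a, c:] * q) k = coeff q k + (if k = 0 then 0 else a * coeff q (k - 1))
      + (if k < 2 then 0 else c * coeff q (k - 2))" for q :: "real poly" and k
    by (cases k; cases "k - 1") (auto simp: mult_pCons_left)
  show 0: "coeff ([:1, a, c:] ^ m) 0 = 1" for m
    by (induction m) (simp_all only: power_0 power_Suc rec, simp_all)
  show 1: "coeff ([:1, a, c:] ^ m) (Suc 0) = real m * a" for m
    by (induction m) (simp_all only: power_0 power_Suc rec, simp_all add: 0 algebra_simps)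
  show "coeff ([:1, a, c:] ^ m) 2 = real m * c + real m * (real m - 1) / 2 * a\<^sup>2"
    by (induction m) (simp_all only: power_0 power_Suc rec, simp_all add: 0 1 field_simps power2_eq_square)
qed

text \<open>
  The law of one spherical vector without an atom at the origin. From \<open>n = 5\<close> on, the exponent
  \<open>n / 2 - 2\<close> of the density of a correlation is positive, so that this density is continuous on
  \<open>[- 1, 1]\<close>; for the limit theorem only large \<open>n\<close> matter.
\<close>

locale isotropic_law = prob_space \<mu> for \<mu> :: "(nat \<Rightarrow> real) measure" +
  fixes n :: nat
  assumes dim: "n \<ge> 5"
    and sets_law [measurable_cong]: "sets \<mu> = sets (borel_vec n)"
    and rotate: "\<And>A. orthogonal_mat n A \<Longrightarrow> distr \<mu> (borel_vec n) (matrix_vec n A) = \<mu>"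
    and no_atom_0: "measure \<mu> {x \<in> space \<mu>. \<forall>k\<in>{1..n}. x k = 0} = 0"
begin

lemma n1: "n \<ge> 1" using dim by simp

lemma expectation_rotate:
  fixes f :: "(nat \<Rightarrow> real) \<Rightarrow> real"
  assumes "orthogonal_mat n A" and f: "f \<in> borel_measurable (borel_vec n)"
  shows "(\<integral>x. f (matrix_vec n A x) \<partial>\<mu>) = (\<integral>x. f x \<partial>\<mu>)"
proof -
  have "(\<integral>x. f x \<partial>\<mu>) = (\<integral>x. f x \<partial>distr \<mu> (borel_vec n) (matrix_vec n A))"
    unfolding rotate[OF assms(1)] ..
  also have "\<dots> = (\<integral>x. f (matrix_vec n A x) \<partial>\<mu>)"
    by (rule integral_distr) (use f in measurable)
  finally show ?thesis by simp
qed

lemma measure_rotate: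
  assumes "orthogonal_mat n A" and D: "D \<in> sets (borel_vec n)"
  shows "measure \<mu> D = measure \<mu> (matrix_vec n A -` D \<inter> space \<mu>)"
proof -
  have "measure \<mu> D = measure (distr \<mu> (borel_vec n) (matrix_vec n A)) D"
    unfolding rotate[OF assms(1)] ..
  also have "\<dots> = measure \<mu> (matrix_vec n A -` D \<inter> space \<mu>)"
    by (rule measure_distr) (use D in measurable)
  finally show ?thesis .
qed

text \<open>
  A random vector on the line of constant vectors, outside the origin, is carried by reflections to
  infinitely many other lines through the origin. These lines meet only in the origin and each has at
  least the probability of the first, so this probability is zero.
\<close>

lemma AE_spread_nonzero: "AE x in \<mu>. spread n x \<noteq> 0"
proof -
  define C where "C = {x \<in> space \<mu>. spread n x = 0 \<and> \<not> (\<forall>i\<in>{1..n}. x i = 0)}"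
  have C: "C \<in> sets \<mu>" unfolding C_def by measurable
  define D where "D k = {x \<in> space \<mu>. x 1 \<noteq> 0 \<and> x 2 = real k * x 1}" for k :: nat
  have comp: "(\<lambda>x. x i) \<in> borel_measurable \<mu>" if "i \<in> {1..n}" for i
    unfolding measurable_cong_sets[OF sets_law refl] using that by (rule measurable_component_singleton)
  have c12 [measurable]: "(\<lambda>x. x 1) \<in> borel_measurable \<mu>" "(\<lambda>x. x 2) \<in> borel_measurable \<mu>"
    using dim by (intro comp; simp)+
  have D: "D k \<in> sets \<mu>" for k 
  proof -
    have "D k = ((\<lambda>x. x 1) -` (- {0}) \<inter> space \<mu>) \<inter> ((\<lambda>x. x 2 - real k * x 1) -` {0} \<inter> space \<mu>)"
      by (auto simp: D_def)
    also have "\<dots> \<in> sets \<mu>"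
    proof (rule sets.Int)
      show "(\<lambda>x. x 1) -` (- {0}) \<inter> space \<mu> \<in> sets \<mu>"
        by (rule measurable_sets[OF c12(1)]) simp
      have "(\<lambda>x. x 2 - real k * x 1) \<in> borel_measurable \<mu>" by measurable
      then show "(\<lambda>x. x 2 - real k * x 1) -` {0} \<inter> space \<mu> \<in> sets \<mu>"
        by (rule measurable_sets) simp
    qed
    finally show ?thesis .
  qed
  have le: "measure \<mu> C \<le> measure \<mu> (D k)" for k
  proof -
    \<comment> \<open>The target line is spanned by \<open>(1, k, 0, \<dots>, 0)\<close>, scaled to the length of the constant vector 1.\<close>
    define r where "r = sqrt (real n / (1 + (real k)\<^sup>2))"
    define b where "b i = (if i = 1 then r else if i = 2 then r * real k else 0)" for i :: nat
    let ?v = "\<lambda>i. 1 - b i" and ?R = "matrix_vec n (reflection n (\<lambda>i. 1 - b i))"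
    have pos: "1 + (real k)\<^sup>2 > 0" by (simp add: add_pos_nonneg)
    have r: "r > 0" using dim pos by (simp add: r_def)
    have "dotp n b b = (\<Sum>i\<in>{1,2}. b i * b i)"
      unfolding dotp_def using dim by (intro sum.mono_neutral_right) (auto simp: b_def)
    also have "\<dots> = r\<^sup>2 * (1 + (real k)\<^sup>2)" by (simp add: b_def power2_eq_square algebra_simps)
    also have "\<dots> = real n" using pos by (simp add: r_def)
    finally have nb: "dotp n (\<lambda>i. 1) (\<lambda>i. 1) = dotp n b b" by (simp add: dotp_def)
    have "C \<subseteq> ?R -` D k \<inter> space \<mu>"
    proof
      fix x assume x: "x \<in> C"
      define s where "s = mean n x"
      have xs: "x i = s * 1" if "i \<in> {1..n}" for i
        using x that by (auto simp: C_def spread_eq_0 s_def)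
      have s0: "s \<noteq> 0" using x xs by (auto simp: C_def)
      have R: "?R x i = s * b i" if "i \<in> {1..n}" for i
        using nb that xs by (rule reflection_swap)
      have "?R x \<in> space \<mu>"
        using x by (auto simp: C_def sets_eq_imp_space_eq[OF sets_law] space_PiM matrix_vec_def)
      then show "x \<in> ?R -` D k \<inter> space \<mu>"
        using x R[of 1] R[of 2] s0 r dim by (auto simp: D_def C_def b_def)
    qed
    then have "measure \<mu> C \<le> measure \<mu> (?R -` D k \<inter> space \<mu>)"
      by (rule finite_measure_mono) (use D in measurable)
    also have "\<dots> = measure \<mu> (D k)"
      using D by (intro measure_rotate[symmetric] orthogonal_reflection) (simp add: sets_law)
    finally show ?thesis .
  qed
  have "real K * measure \<mu> C \<le> 1" for K
  proof -
    have "real K * measure \<mu> C \<le> (\<Sum>k<K. measure \<mu> (D k))"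
      using sum_mono[of "{..<K}" "\<lambda>_. measure \<mu> C" "\<lambda>k. measure \<mu> (D k)"] le by simp
    also have "\<dots> = measure \<mu> (\<Union>k<K. D k)"
      by (intro finite_measure_finite_Union[symmetric])
         (use D in \<open>auto simp: disjoint_family_on_def D_def\<close>)
    finally show ?thesis using prob_le_1 order_trans by blast
  qed
  then have "measure \<mu> C = 0"
    using reals_Archimedean3[of "measure \<mu> C"] measure_nonneg[of \<mu> C]
    by (metis less_le not_less)
  then have "AE x in \<mu>. x \<notin> C" using C by (simp add: prob_eq_0)
  moreover have "AE x in \<mu>. \<not> (\<forall>i\<in>{1..n}. x i = 0)"
  proof -
    have "{x \<in> space \<mu>. \<forall>k\<in>{1..n}. x k = 0} = (\<Inter>k\<in>{1..n}. (\<lambda>x. x k) -` {0} \<inter> space \<mu>)"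
      using dim by auto
    also have "\<dots> \<in> sets \<mu>"
      using dim by (intro sets.finite_INT measurable_sets[OF comp]) auto
    finally show ?thesis using no_atom_0 by (subst (asm) prob_eq_0) auto
  qed
  ultimately show ?thesis using AE_space by eventually_elim (auto simp: C_def)
qed

definition moment :: "nat \<Rightarrow> (nat \<Rightarrow> real) \<Rightarrow> real" where
  "moment k a = (\<integral>x. (dotp n x a / spread n x) ^ k \<partial>\<mu>)"

text \<open>
  The reflection along \<open>a - b\<close> preserves the law and the spread, and exchanges the inner products with
  \<open>a\<close> and \<open>b\<close>.
\<close>

lemma moment_cong_norm:
  assumes "(\<Sum>i=1..n. a i) = 0" "(\<Sum>i=1..n. b i) = 0" "dotp n a a = dotp n b b"
  shows "moment k a = moment k b"
proof -
  let ?v = "\<lambda>i. a i - b i"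
  have "moment k a = (\<integral>x. (dotp n (matrix_vec n (reflection n ?v) x) a
      / spread n (matrix_vec n (reflection n ?v) x)) ^ k \<partial>\<mu>)"
    unfolding moment_def
    by (rule expectation_rotate[OF orthogonal_reflection, symmetric]) measurable
  also have "\<dots> = moment k b"
    unfolding moment_def dotp_reflection_swap[OF assms(3)]
    using assms(1,2) by (subst spread_reflection[OF n1]) (simp_all add: sum_subtractf)
  finally show ?thesis .
qed

lemma moment_scale: "moment k (\<lambda>i. c * a i) = c ^ k * moment k a"
proof -
  have "(c * dotp n x a / spread n x) ^ k = c ^ k * (dotp n x a / spread n x) ^ k" for x
    by (metis power_mult_distrib times_divide_eq_right)
  then show ?thesis unfolding moment_def dotp_scale_right by simp
qed

lemma even_moment:
  assumes a: "(\<Sum>i=1..n. a i) = 0" and u: "(\<Sum>i=1..n. u i) = 0" "dotp n u u = 1"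
  shows "moment (2 * m) a = dotp n a a ^ m * moment (2 * m) u"
proof -
  define c where "c = sqrt (dotp n a a)"
  have c: "c\<^sup>2 = dotp n a a" by (simp add: c_def dotp_self_nonneg)
  have "dotp n (\<lambda>i. c * u i) (\<lambda>i. c * u i) = c\<^sup>2 * dotp n u u"
    by (simp add: dotp_scale_right dotp_commute[of n "\<lambda>i. c * u i"] power2_eq_square)
  then have "moment (2 * m) a = moment (2 * m) (\<lambda>i. c * u i)"
    using a u c by (intro moment_cong_norm) (simp_all add: sum_distrib_left[symmetric])
  also have "\<dots> = (c\<^sup>2) ^ m * moment (2 * m) u"
    unfolding moment_scale by (simp add: power_mult)
  finally show ?thesis by (simp add: c)
qed

lemma odd_moment:
  assumes u: "(\<Sum>i=1..n. u i) = 0" and k: "odd k"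
  shows "moment k u = 0"
proof -
  have "moment k u = moment k (\<lambda>i. - 1 * u i)"
    using u by (intro moment_cong_norm) (simp_all add: dotp_def sum_negf)
  also have "\<dots> = - moment k u"
    unfolding moment_scale using k by simp
  finally show ?thesis by simp
qed

lemma ratio_bound:
  assumes "(\<Sum>i=1..n. a i) = 0" "dotp n a a \<le> 1"
  shows "\<bar>dotp n x a / spread n x\<bar> \<le> 1"
proof -
  have "sqrt (dotp n a a) \<le> 1" using assms by simp
  then have "spread n x * sqrt (dotp n a a) \<le> spread n x * 1"
    by (intro mult_left_mono) auto
  then have "\<bar>dotp n x a\<bar> \<le> spread n x"
    using dotp_le_spread[OF assms(1), of x] by simp
  then show ?thesis by (cases "spread n x = 0") (auto simp: abs_div divide_le_eq order_le_less)
qed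

text \<open>
  With \<open>m = k + 1\<close>, let \<open>U = \<langle>x, u\<rangle> / spread x\<close> and \<open>W\<^sub>i = (x\<^sub>i - mean x) / spread x\<close>; the latter is the same ratio
  for the centred part \<open>f\<^sub>i\<close> of the \<open>i\<close>-th unit vector. As moments in direction \<open>a\<close> depend on the
  length of \<open>a\<close> only, for every real \<open>t\<close>
  \<open>E (U + t W\<^sub>i) ^ (2 m) = (1 + 2 t u\<^sub>i + t\<^sup>2 (1 - 1 / n)) ^ m * E U ^ (2 m)\<close>.
  Both sides are polynomials in \<open>t\<close>. The coefficient of \<open>t\<^sup>2\<close> expresses the mixed moment of \<open>U ^ (2 m - 2)\<close>
  and \<open>W\<^sub>i\<^sup>2\<close> by the moment of order \<open>2 m\<close>. Summing over \<open>i\<close> removes the mixed moments, as the squares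
  \<open>W\<^sub>i\<^sup>2\<close> add up to 1 almost surely.
\<close>

lemma moment_recursion:
  assumes u: "(\<Sum>i=1..n. u i) = 0" "dotp n u u = 1"
  shows "(2 * real k + 1) * moment (2 * k) u = (2 * real k + real n - 1) * moment (2 * k + 2) u"
proof -
  define m where "m = k + 1"
  define U where "U x = dotp n x u / spread n x" for x
  define f where "f i j = (if j = i then 1 else 0) - 1 / real n" for i j :: nat
  define W where "W i x = dotp n x (f i) / spread n x" for i x
  have n0: "real n > 0" using dim by simp
  have f0: "(\<Sum>j=1..n. f i j) = 0" if "i \<in> {1..n}" for i
    using that n0 unfolding f_def by (simp add: sum_subtractf)
  have dotf: "dotp n x (f i) = x i - mean n x" if "i \<in> {1..n}" for i x
  proof -
    have "dotp n x (f i) = (\<Sum>j=1..n. (if j = i then x j else 0) - 1 / real n * x j)"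
      unfolding dotp_def f_def by (intro sum.cong) (auto simp: algebra_simps)
    also have "\<dots> = x i - 1 / real n * (\<Sum>j=1..n. x j)"
      using that unfolding sum_subtractf sum_distrib_left[symmetric] by simp
    finally show ?thesis by (simp add: mean_def)
  qed
  have fu: "dotp n u (f i) = u i" if "i \<in> {1..n}" for i
    using that u(1) by (simp add: dotf mean_def)
  have ff: "dotp n (f i) (f i) = 1 - 1 / real n" if "i \<in> {1..n}" for i
  proof -
    have "mean n (f i) = 0" unfolding mean_def f0[OF that] by simp
    then show ?thesis using dotf[OF that, of "f i"] by (simp add: f_def)
  qed
  have Um: "U \<in> borel_measurable \<mu>" unfolding U_def by measurable
  have Wm: "W i \<in> borel_measurable \<mu>" for i unfolding W_def by measurable
  have Ub: "\<bar>U x\<bar> \<le> 1" for x unfolding U_def using u by (intro ratio_bound) auto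
  have Wb: "\<bar>W i x\<bar> \<le> 1" if "i \<in> {1..n}" for i x
    unfolding W_def using that by (intro ratio_bound f0) (auto simp: ff)
  have int: "integrable \<mu> (\<lambda>x. W i x ^ j * U x ^ l)" if "i \<in> {1..n}" for i j l
  proof (rule integrable_const_bound[where B=1])
    show "AE x in \<mu>. norm (W i x ^ j * U x ^ l) \<le> 1"
      using Ub Wb[OF that] by (auto simp: abs_mult power_abs intro!: mult_le_one power_le_one)
  qed (use Um Wm in measurable)
  have coeff: "real (2 * m choose 2) * (\<integral>x. (W i x)\<^sup>2 * U x ^ (2 * m - 2) \<partial>\<mu>)
      = moment (2 * m) u * (real m * (1 - 1 / real n) + 2 * real m * (real m - 1) * (u i)\<^sup>2)"
    if i: "i \<in> {1..n}" for i
  proof -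
    define Ee where "Ee j = real (2 * m choose j) * (\<integral>x. W i x ^ j * U x ^ (2 * m - j) \<partial>\<mu>)" for j
    let ?P = "\<Sum>j\<le>2 * m. monom (Ee j) j"
    let ?Q = "smult (moment (2 * m) u) ([:1, 2 * u i, 1 - 1 / real n:] ^ m)"
    have "poly ?P t = poly ?Q t" for t
    proof -
      let ?a = "\<lambda>j. u j + t * f i j"
      have "dotp n ?a ?a = dotp n u u + 2 * dotp n u (f i) * t + dotp n (f i) (f i) * t\<^sup>2"
        by (simp add: dotp_add_right dotp_scale_right dotp_commute[of n "\<lambda>j. u j + t * f i j"]
            dotp_commute[of n "f i" u] algebra_simps power2_eq_square)
      then have "dotp n ?a ?a = 1 + 2 * u i * t + (1 - 1 / real n) * t\<^sup>2"
        unfolding u(2) fu[OF i] ff[OF i] .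
      moreover have "(\<Sum>j=1..n. ?a j) = 0"
        using u f0[OF i] by (simp add: sum.distrib sum_distrib_left[symmetric])
      ultimately have "moment (2 * m) ?a = (1 + 2 * u i * t + (1 - 1 / real n) * t\<^sup>2) ^ m * moment (2 * m) u"
        using even_moment[of ?a u m] u by simp
      moreover have "moment (2 * m) ?a = poly ?P t"
      proof -
        have "moment (2 * m) ?a = (\<integral>x. (t * W i x + U x) ^ (2 * m) \<partial>\<mu>)"
          unfolding moment_def U_def W_def dotp_add_right dotp_scale_right
          by (simp add: add_divide_distrib add.commute)
        also have "\<dots> = (\<integral>x. (\<Sum>j\<le>2 * m. (real (2 * m choose j) * t ^ j) * (W i x ^ j * U x ^ (2 * m - j))) \<partial>\<mu>)"
          unfolding binomial_ring by (simp add: power_mult_distrib mult_ac)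
        also have "\<dots> = (\<Sum>j\<le>2 * m. (real (2 * m choose j) * t ^ j) * (\<integral>x. W i x ^ j * U x ^ (2 * m - j) \<partial>\<mu>))"
          by (subst Bochner_Integration.integral_sum) (use int[OF i] in auto)
        also have "\<dots> = poly ?P t"
          by (simp add: poly_sum poly_monom Ee_def mult_ac)
        finally show ?thesis .
      qed
      ultimately show ?thesis
        by (simp add: algebra_simps power2_eq_square)
    qed
    then have "?P = ?Q" by (simp add: poly_eq_poly_eq_iff[symmetric] fun_eq_iff)
    then have "coeff ?P 2 = coeff ?Q 2" by simp
    moreover have "coeff ?P 2 = Ee 2"
      by (simp add: coeff_sum m_def numeral_2_eq_2)
    ultimately show ?thesis
      by (simp add: Ee_def coeff_quadratic_power(3) power_mult_distrib mult.assoc)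
  qed
  have "(\<Sum>i=1..n. \<integral>x. (W i x)\<^sup>2 * U x ^ (2 * m - 2) \<partial>\<mu>)
      = (\<integral>x. (\<Sum>i=1..n. (W i x)\<^sup>2 * U x ^ (2 * m - 2)) \<partial>\<mu>)"
    by (rule Bochner_Integration.integral_sum[symmetric]) (use int in auto)
  also have "\<dots> = (\<integral>x. U x ^ (2 * m - 2) \<partial>\<mu>)"
  proof (rule integral_cong_AE)
    show "AE x in \<mu>. (\<Sum>i=1..n. (W i x)\<^sup>2 * U x ^ (2 * m - 2)) = U x ^ (2 * m - 2)"
      using AE_spread_nonzero
    proof eventually_elim
      case (elim x)
      have "(\<Sum>i=1..n. (W i x)\<^sup>2) = (\<Sum>i=1..n. (centred n x i)\<^sup>2) / (spread n x)\<^sup>2"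
        unfolding sum_divide_distrib by (intro sum.cong) (auto simp: W_def dotf centred_def power_divide)
      also have "(\<Sum>i=1..n. (centred n x i)\<^sup>2) = (spread n x)\<^sup>2"
        unfolding spread_def by (simp add: dotp_self_nonneg) (simp add: dotp_def power2_eq_square)
      finally show ?case using elim by (simp add: sum_distrib_right[symmetric])
    qed
  qed (use Um Wm in measurable)
  finally have "real (2 * m choose 2) * moment (2 * m - 2) u
      = (\<Sum>i=1..n. real (2 * m choose 2) * (\<integral>x. (W i x)\<^sup>2 * U x ^ (2 * m - 2) \<partial>\<mu>))"
    unfolding moment_def U_def[symmetric] by (simp add: sum_distrib_left[symmetric])
  also have "\<dots> = (\<Sum>i=1..n. moment (2 * m) u * (real m * (1 - 1 / real n) + 2 * real m * (real m - 1) * (u i)\<^sup>2))"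
    by (intro sum.cong refl coeff)
  also have "\<dots> = moment (2 * m) u * (real n * (real m * (1 - 1 / real n)) + 2 * real m * (real m - 1) * (\<Sum>i=1..n. (u i)\<^sup>2))"
    unfolding sum_distrib_left[symmetric] sum.distrib by simp
  also have "(\<Sum>i=1..n. (u i)\<^sup>2) = 1" using u(2) by (simp add: dotp_def power2_eq_square)
  also have "real n * (real m * (1 - 1 / real n)) = real m * (real n - 1)"
    using n0 by (simp add: field_simps)
  finally have "real (2 * m choose 2) * moment (2 * m - 2) u
      = real m * ((2 * real k + real n - 1) * moment (2 * m) u)"
    by (simp add: m_def algebra_simps)
  moreover have "real (2 * m choose 2) = real m * (2 * real k + 1)"
  proof -
    have "2 * m choose 2 = m * (2 * m - 1)" by (simp add: choose_two)
    then show ?thesis by (simp add: m_def algebra_simps)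
  qed
  ultimately have "real m * ((2 * real k + 1) * moment (2 * m - 2) u)
      = real m * ((2 * real k + real n - 1) * moment (2 * m) u)"
    by simp
  then show ?thesis by (simp add: m_def)
qed

text \<open>
  The moments of the correlation satisfy the recursion of the moments of the sphere law; both start
  at 1 and vanish in odd order, so the two laws agree.
\<close>

lemma measure_abs_pearson_gt:
  assumes y: "spread n y \<noteq> 0" and t: "0 \<le> t" "t \<le> 1"
  shows "measure \<mu> {x \<in> space \<mu>. t < \<bar>pearson n x y\<bar>} = sphere_tail n t / sphere_tail n 0"
proof -
  define u where "u = (\<lambda>i. inverse (spread n y) * centred n y i)"
  define U where "U x = dotp n x u / spread n x" for x
  have pU: "pearson n x y = U x" for x
    unfolding pearson_altdef[OF n1] U_def u_def ..
  have u0: "(\<Sum>i=1..n. u i) = 0"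
    unfolding u_def sum_distrib_left[symmetric] sum_centred[OF n1] by simp
  have u1: "dotp n u u = 1"
  proof -
    have "dotp n u u = inverse (spread n y) * (inverse (spread n y) * dotp n (centred n y) (centred n y))"
      unfolding u_def dotp_scale_right by (subst dotp_commute) (simp only: dotp_scale_right)
    also have "dotp n (centred n y) (centred n y) = spread n y * spread n y"
      by (simp add: spread_def dotp_self_nonneg)
    finally show ?thesis using y by (simp add: field_simps)
  qed
  have Um [measurable]: "U \<in> borel_measurable \<mu>" unfolding U_def by measurable
  interpret P: real_distribution "distr \<mu> borel U" by (rule real_distribution_distr) measurable
  interpret Q: real_distribution "sphere_law n" by (rule real_distribution_sphere_law[OF dim])
  have "distr \<mu> borel U = sphere_law n"
  proof (rule real_distribution_eq_of_moments)
    have "\<bar>U x\<bar> \<le> 1" for x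
      unfolding U_def by (rule ratio_bound[OF u0]) (simp add: u1)
    then show "AE x in distr \<mu> borel U. \<bar>x\<bar> \<le> 1"
      by (subst AE_distr_iff) auto
    show "AE x in sphere_law n. \<bar>x\<bar> \<le> 1" by (rule AE_sphere_law[OF dim])
    have even: "moment (2 * k) u = (\<integral>x. x ^ (2 * k) \<partial>sphere_law n)" for k
    proof (induction k)
      case 0
      show ?case using prob_space Q.prob_space by (simp add: moment_def)
    next
      case (Suc k)
      have "2 * real k + real n - 1 > 0" using dim by simp
      moreover have "(2 * real k + real n - 1) * moment (2 * k + 2) u
          = (2 * real k + real n - 1) * (\<integral>x. x ^ (2 * k + 2) \<partial>sphere_law n)"
        unfolding moment_recursion[OF u0 u1, symmetric] sphere_law_moments(1)[OF dim, symmetric] Suc ..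
      ultimately show ?case by simp
    qed
    show "(\<integral>x. x ^ k \<partial>distr \<mu> borel U) = (\<integral>x. x ^ k \<partial>sphere_law n)" for k
    proof -
      have "(\<integral>x. x ^ k \<partial>distr \<mu> borel U) = moment k u"
        unfolding moment_def U_def[symmetric] by (rule integral_distr) measurable
      also have "\<dots> = (\<integral>x. x ^ k \<partial>sphere_law n)"
        using even odd_moment[OF u0, of k] sphere_law_moments(2)[OF dim, of k]
        by (cases "even k") (auto elim!: evenE)
      finally show ?thesis .
    qed
  qed unfold_locales
  then have "measure (sphere_law n) {r. t < \<bar>r\<bar>} = measure (distr \<mu> borel U) {r. t < \<bar>r\<bar>}" by simp
  also have "\<dots> = measure \<mu> (U -` {r. t < \<bar>r\<bar>} \<inter> space \<mu>)"
    by (rule measure_distr) measurable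
  also have "U -` {r. t < \<bar>r\<bar>} \<inter> space \<mu> = {x \<in> space \<mu>. t < \<bar>pearson n x y\<bar>}"
    by (auto simp: pU)
  finally show ?thesis using measure_sphere_law[OF dim t] by simp
qed

end

section \<open>The maximal correlation\<close>

lemma coherence_pairs:
  fixes n :: nat and x :: "nat \<Rightarrow> nat \<Rightarrow> real"
  assumes "2 \<le> p"
  defines "R \<equiv> {\<bar>pearson n (x i) (x j)\<bar> | i j. 1 \<le> i \<and> i < j \<and> j \<le> p}"
  shows "finite R" "R \<noteq> {}"
proof -
  have "R \<subseteq> (\<lambda>(i, j). \<bar>pearson n (x i) (x j)\<bar>) ` ({1..p} \<times> {1..p})"
    unfolding R_def by auto
  then show "finite R" by (rule finite_subset) auto
  have "\<bar>pearson n (x 1) (x 2)\<bar> \<in> R" unfolding R_def using assms by fastforce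
  then show "R \<noteq> {}" by auto
qed

lemma coherence_le_iff:
  assumes "2 \<le> p"
  shows "coherence n p x \<le> t \<longleftrightarrow> (\<forall>i j. 1 \<le> i \<and> i < j \<and> j \<le> p \<longrightarrow> \<not> t < \<bar>pearson n (x i) (x j)\<bar>)"
  unfolding coherence_def Max_le_iff[OF coherence_pairs[OF assms]]
  by (simp only: mem_Collect_eq not_less Ball_def) blast

lemma coherence_nonneg:
  assumes "2 \<le> p" shows "0 \<le> coherence n p x"
proof -
  have "\<bar>pearson n (x 1) (x 2)\<bar> \<le> coherence n p x"
    using coherence_le_iff[OF assms, of n x "coherence n p x"] assms by (auto simp: not_less)
  then show ?thesis by linarith
qed

lemma coherence_measurable:
  assumes "2 \<le> p" and X: "\<And>i. i \<in> {1..p} \<Longrightarrow> X i \<in> measurable M (borel_vec n)"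
  shows "(\<lambda>\<omega>. coherence n p (\<lambda>i. X i \<omega>)) \<in> borel_measurable M"
proof (rule borel_measurableI_le)
  fix t
  have "(\<lambda>\<omega>. pearson n (X i \<omega>) (X j \<omega>)) \<in> borel_measurable M" if "i \<in> {1..p}" "j \<in> {1..p}" for i j
    using measurable_compose[OF measurable_Pair[OF X X, OF that] pearson_measurable] by simp
  then have "{\<omega> \<in> space M. t < \<bar>pearson n (X i \<omega>) (X j \<omega>)\<bar>} \<in> sets M" if "i \<in> {1..p}" "j \<in> {1..p}" for i j
    using that by measurable
  then have "space M - (\<Union>j\<in>{1..p}. \<Union>i\<in>{1..<j}. {\<omega> \<in> space M. t < \<bar>pearson n (X i \<omega>) (X j \<omega>)\<bar>}) \<in> sets M"
    by (intro sets.Diff sets.finite_UN sets.top) auto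
  also have "space M - (\<Union>j\<in>{1..p}. \<Union>i\<in>{1..<j}. {\<omega> \<in> space M. t < \<bar>pearson n (X i \<omega>) (X j \<omega>)\<bar>})
      = {\<omega> \<in> space M. coherence n p (\<lambda>i. X i \<omega>) \<le> t}"
    unfolding coherence_le_iff[OF assms(1)] by force
  finally show "{\<omega> \<in> space M. coherence n p (\<lambda>i. X i \<omega>) \<le> t} \<in> sets M" .
qed

text \<open>
  The graph estimate for the relation \<open>t < \<bar>pearson n x y\<bar>\<close>, which is isotropic at every \<open>y\<close> that is
  not constant, hence almost everywhere.
\<close>

lemma (in prob_space) prob_coherence_le_approx:
  fixes X :: "nat \<Rightarrow> 'a \<Rightarrow> nat \<Rightarrow> real"
  assumes n: "n \<ge> 5" and p: "p \<ge> 2" and t: "0 \<le> t" "t \<le> 1"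
    and indep: "indep_vars (\<lambda>_. borel_vec n) X {1..p}"
    and identical: "\<And>i. i \<in> {1..p} \<Longrightarrow> distr M (borel_vec n) (X i) = distr M (borel_vec n) (X 1)"
    and spherical: "spherical M n (X 1)"
    and nonzero: "prob {\<omega> \<in> space M. \<forall>k\<in>{1..n}. X 1 \<omega> k = 0} = 0"
  defines "q \<equiv> sphere_tail n t / sphere_tail n 0"
  shows "\<bar>prob {\<omega> \<in> space M. coherence n p (\<lambda>i. X i \<omega>) \<le> t} - exp (- (q * real p * (real p - 1) / 2))\<bar>
       \<le> real p ^ 3 * q\<^sup>2"
proof -
  let ?\<mu> = "distr M (borel_vec n) (X 1)"
  have X1: "random_variable (borel_vec n) (X 1)" using spherical by (simp add: spherical_def)
  interpret \<mu>: prob_space ?\<mu> using X1 by (rule prob_space_distr)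
  interpret isotropic_law ?\<mu> n
  proof
    show "5 \<le> n" by (rule n)
    show "sets ?\<mu> = sets (borel_vec n)" by (rule sets_distr)
    show "distr ?\<mu> (borel_vec n) (matrix_vec n A) = ?\<mu>" if "orthogonal_mat n A" for A
    proof -
      have "distr ?\<mu> (borel_vec n) (matrix_vec n A) = distr M (borel_vec n) (matrix_vec n A \<circ> X 1)"
        using X1 by (intro distr_distr) measurable
      then show ?thesis using spherical that by (simp add: spherical_def comp_def)
    qed
    have "{x \<in> space (borel_vec n). \<forall>k\<in>{1..n}. x k = 0} = (\<Inter>k\<in>{1..n}. (\<lambda>x. x k) -` {0} \<inter> space (borel_vec n))"
      using n by auto
    also have "\<dots> \<in> sets (borel_vec n)"
      using n by (intro sets.finite_INT measurable_sets[OF measurable_component_singleton]) auto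
    finally have Z: "{x \<in> space (borel_vec n). \<forall>k\<in>{1..n}. x k = 0} \<in> sets (borel_vec n)" .
    have "measure ?\<mu> {x \<in> space (borel_vec n). \<forall>k\<in>{1..n}. x k = 0}
        = prob (X 1 -` {x \<in> space (borel_vec n). \<forall>k\<in>{1..n}. x k = 0} \<inter> space M)"
      using X1 Z by (rule measure_distr)
    also have "X 1 -` {x \<in> space (borel_vec n). \<forall>k\<in>{1..n}. x k = 0} \<inter> space M
        = {\<omega> \<in> space M. \<forall>k\<in>{1..n}. X 1 \<omega> k = 0}"
      using measurable_space[OF X1] by auto
    finally show "measure ?\<mu> {x \<in> space ?\<mu>. \<forall>k\<in>{1..n}. x k = 0} = 0"
      using nonzero unfolding space_distr by simp
  qed
  have E: "Measurable.pred (borel_vec n \<Otimes>\<^sub>M borel_vec n) (\<lambda>z. t < \<bar>pearson n (fst z) (snd z)\<bar>)"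
    by measurable
  have "AE y in ?\<mu>. measure ?\<mu> {x \<in> space (borel_vec n). t < \<bar>pearson n x y\<bar>} = q"
    using AE_spread_nonzero
    by eventually_elim (use measure_abs_pearson_gt[OF _ t] in \<open>simp add: q_def\<close>)
  then have q: "AE y in distr M (borel_vec n) (X i).
      measure (distr M (borel_vec n) (X k)) {x \<in> space (borel_vec n). t < \<bar>pearson n x y\<bar>} = q"
    if "i \<in> {1..p}" "k \<in> {1..p}" for i k
    unfolding identical[OF that(1)] identical[OF that(2)] .
  have "q = measure (sphere_law n) {r. t < \<bar>r\<bar>}" by (simp add: q_def measure_sphere_law n t)
  then have "0 \<le> q" by simp
  then show ?thesis
    unfolding coherence_le_iff[OF p]
    by (intro prob_no_edge_approx[OF indep E _ q]) (simp_all add: pearson_commute)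
qed

lemma cdf_gumbel:
  fixes c a :: real
  assumes c: "c > 0"
  shows "cdf (interval_measure (\<lambda>y. exp (- c * exp (- (y + a) / 2)))) = (\<lambda>y. exp (- c * exp (- (y + a) / 2)))"
proof (rule cdf_interval_measure)
  show "exp (- c * exp (- (x + a) / 2)) \<le> exp (- c * exp (- (y + a) / 2))" if "x \<le> y" for x y
    using that c by simp
  show "continuous (at_right z) (\<lambda>y. exp (- c * exp (- (y + a) / 2)))" for z
    by (intro continuous_intros) simp
  show "((\<lambda>y. exp (- c * exp (- (y + a) / 2))) \<longlongrightarrow> 0) at_bot"
    using c by real_asymp
qed

theorem corollary2p2:
  fixes p :: "nat \<Rightarrow> nat"
    and \<alpha> :: real
    and M :: "nat \<Rightarrow> 'a measure"
    and X :: "nat \<Rightarrow> nat \<Rightarrow> 'a \<Rightarrow> nat \<Rightarrow> real"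
  assumes p_infinity: "filterlim p at_top sequentially"
    and alpha: "0 \<le> \<alpha>"
    and growth: "(\<lambda>n. ln (real (p n)) / sqrt (real n)) \<longlonglongrightarrow> \<alpha>"
    and prob: "\<And>n. 1 \<le> n \<Longrightarrow> prob_space (M n)"
    and indep: "\<And>n. 1 \<le> n \<Longrightarrow>
      prob_space.indep_vars (M n) (\<lambda>_. borel_vec n) (X n) {1..p n}"
    and identical: "\<And>n i j. 1 \<le> n \<Longrightarrow> i \<in> {1..p n} \<Longrightarrow> j \<in> {1..p n} \<Longrightarrow>
      distr (M n) (borel_vec n) (X n i) = distr (M n) (borel_vec n) (X n j)"
    and spherical: "\<And>n i. 1 \<le> n \<Longrightarrow> i \<in> {1..p n} \<Longrightarrow> spherical (M n) n (X n i)"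
    and nonzero: "\<And>n. 1 \<le> n \<Longrightarrow> 1 \<le> p n \<Longrightarrow>
      measure (M n) {\<omega> \<in> space (M n). \<forall>k\<in>{1..n}. X n 1 \<omega> k = 0} = 0"
  shows "weak_conv_m
    (\<lambda>n. distr (M n) borel
       (\<lambda>\<omega>. real n * (coherence n (p n) (\<lambda>i. X n i \<omega>))\<^sup>2
             - 4 * ln (real (p n)) + ln (ln (real (p n)))))
    (interval_measure (\<lambda>y. exp (- (1 / sqrt (8 * pi)) * exp (- (y + 8 * \<alpha>\<^sup>2) / 2))))"
proof -
  let ?F = "\<lambda>y. exp (- (1 / sqrt (8 * pi)) * exp (- (y + 8 * \<alpha>\<^sup>2) / 2))"
  let ?T = "\<lambda>n \<omega>. real n * (coherence n (p n) (\<lambda>i. X n i \<omega>))\<^sup>2 - 4 * ln (real (p n)) + ln (ln (real (p n)))"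
  have "(\<lambda>n. cdf (distr (M n) borel (?T n)) y) \<longlonglongrightarrow> ?F y" for y
  proof -
    define v where "v n = y + 4 * ln (real (p n)) - ln (ln (real (p n)))" for n
    define t where "t n = sqrt (v n / real n)" for n
    define q where "q n = sphere_tail n (t n) / sphere_tail n 0" for n
    define \<Lambda> where "\<Lambda> = exp (- (y + 8 * \<alpha>\<^sup>2) / 2) / sqrt (2 * pi)"
    have v01: "\<forall>\<^sub>F n in sequentially. 0 < v n \<and> v n < real n"
      unfolding v_def by (rule scaled_tail_limit(1)[OF p_infinity growth])
    have lim: "(\<lambda>n. (real (p n))\<^sup>2 * q n) \<longlonglongrightarrow> \<Lambda>"
      unfolding q_def t_def v_def \<Lambda>_def by (rule scaled_tail_limit(2)[OF p_infinity growth])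
    have inv: "(\<lambda>n. inverse (real (p n))) \<longlonglongrightarrow> 0"
      by (intro tendsto_inverse_0_at_top filterlim_compose[OF filterlim_real_sequentially p_infinity])
    have p2: "\<forall>\<^sub>F n in sequentially. p n \<ge> 2"
      using p_infinity by (simp add: filterlim_at_top)
    have err: "(\<lambda>n. real (p n) ^ 3 * (q n)\<^sup>2) \<longlonglongrightarrow> 0"
    proof -
      have "(\<lambda>n. ((real (p n))\<^sup>2 * q n)\<^sup>2 * inverse (real (p n))) \<longlonglongrightarrow> \<Lambda>\<^sup>2 * 0"
        by (intro tendsto_intros lim inv)
      moreover have "((real (p n))\<^sup>2 * q n)\<^sup>2 * inverse (real (p n)) = real (p n) ^ 3 * (q n)\<^sup>2" for n
        by (cases "p n = 0") (auto simp: power2_eq_square power3_eq_cube)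
      ultimately show ?thesis by simp
    qed
    have approx: "(\<lambda>n. exp (- (q n * real (p n) * (real (p n) - 1) / 2))) \<longlonglongrightarrow> ?F y"
    proof -
      have L: "(\<lambda>n. exp (- ((real (p n))\<^sup>2 * q n * (1 - inverse (real (p n))) / 2))) \<longlonglongrightarrow> exp (- (\<Lambda> * (1 - 0) / 2))"
        by (intro tendsto_intros lim inv) simp
      have r: "(real (p n))\<^sup>2 * q n * (1 - inverse (real (p n))) = q n * real (p n) * (real (p n) - 1)" for n
        by (cases "p n = 0") (auto simp: power2_eq_square field_simps)
      have "sqrt (8 * pi) = 2 * sqrt (2 * pi)"
        by (simp add: real_sqrt_mult[symmetric] real_sqrt_unique)
      then have s: "exp (- (\<Lambda> * (1 - 0) / 2)) = ?F y"
        by (simp add: \<Lambda>_def mult.commute)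
      show ?thesis using L unfolding r s .
    qed
    have "\<forall>\<^sub>F n in sequentially. \<bar>cdf (distr (M n) borel (?T n)) y - exp (- (q n * real (p n) * (real (p n) - 1) / 2))\<bar>
        \<le> real (p n) ^ 3 * (q n)\<^sup>2"
      using v01 p2 eventually_ge_at_top[of 5]
    proof eventually_elim
      case (elim n)
      then have n1: "1 \<le> n" by simp
      interpret prob_space "M n" by (rule prob[OF n1])
      have rv: "random_variable (borel_vec n) (X n i)" if "i \<in> {1..p n}" for i
        using spherical[OF n1 that] by (simp add: spherical_def)
      have [measurable]: "(\<lambda>\<omega>. coherence n (p n) (\<lambda>i. X n i \<omega>)) \<in> borel_measurable (M n)"
        using elim rv by (intro coherence_measurable)
      have "?T n \<omega> \<le> y \<longleftrightarrow> coherence n (p n) (\<lambda>i. X n i \<omega>) \<le> t n" for \<omega>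
      proof -
        let ?L = "coherence n (p n) (\<lambda>i. X n i \<omega>)"
        have "?T n \<omega> \<le> y \<longleftrightarrow> ?L\<^sup>2 \<le> v n / real n"
          using elim by (simp add: v_def field_simps)
        also have "\<dots> \<longleftrightarrow> ?L \<le> t n"
          unfolding t_def using coherence_nonneg[OF elim(2), of n "\<lambda>i. X n i \<omega>"] elim
          by (metis abs_of_nonneg real_sqrt_abs real_sqrt_le_iff)
        finally show ?thesis .
      qed
      then have "cdf (distr (M n) borel (?T n)) y = prob {\<omega> \<in> space (M n). coherence n (p n) (\<lambda>i. X n i \<omega>) \<le> t n}"
        unfolding cdf_def by (subst measure_distr) (auto intro!: arg_cong[where f=prob])
      moreover have "0 \<le> t n" "t n \<le> 1" using elim by (auto simp: t_def)
      moreover have "1 \<in> {1..p n}" using elim by auto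
      ultimately show ?case
        unfolding q_def
        using prob_coherence_le_approx[OF elim(3,2) _ _ indep[OF n1] identical[OF n1]
            spherical[OF n1] nonzero[OF n1], of "t n"] by simp
    qed
    then have "(\<lambda>n. cdf (distr (M n) borel (?T n)) y - exp (- (q n * real (p n) * (real (p n) - 1) / 2))) \<longlonglongrightarrow> 0"
      by (intro Lim_null_comparison[OF _ err]) simp
    from tendsto_add[OF this approx] show ?thesis by simp
  qed
  moreover have "cdf (interval_measure ?F) = ?F"
    by (rule cdf_gumbel) simp
  ultimately show ?thesis
    unfolding weak_conv_m_def weak_conv_def by simp
qed

end
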